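(* Let $\alpha\in(0,1)$ and let $\alpha_0\in(0,1)$ be the smallest solution $\alpha$ of $$\frac{r_0^2\left((\alpha-1)r_0+\cos\theta\,(1-\alpha r_0^2)\right)^2}{h_1^2}+\frac{r_0^2(1+\alpha r_0^2)^2\sin^2\theta}{h_2^2}=N,$$ where $\theta\in(0,\pi/2)$ (that is, the smallest $\alpha\in(0,1)$ for which the equation holds for some $\theta\in(0,\pi/2)$; here $r_0,h_1,h_2,N$ depend on $\alpha$), $$N=(1+r_0^2-2r_0\cos\theta)^2(1+\alpha^2r_0^2+2\alpha r_0\cos\theta)^2$$ and $$r_0=\frac{-(1+(1-\alpha)h_1)+\sqrt{(1+(1-\alpha)h_1)^2+4\alpha h_1^2}}{2\alpha h_1}.$$ If $f\in\mathcal{S}^*_{cs}(\alpha)$, then for the disc $|z|\le r_{cs}<1$, $f\in\mathcal{F}[A,B]$, where $r_{cs}$ is given as follows: - $r_{cs}=r_0$ for $A=-B=\alpha\le\alpha_0$; - $r_{cs}=r_1:=\dfrac{-(1+(1-\alpha)h_2)+\sqrt{(1+(1-\alpha)h_2)^2+4\alpha h_2^2}}{2\alpha h_2}$ for $A=-B=\alpha>\alpha_0$; - $r_{cs}=r_2:=\dfrac{-(1+(1-\alpha)(k_1+k))+\sqrt{(1+(1-\alpha)(k_1+k))^2+4\alpha(k_1+k)^2}}{2\alpha(k_1+k)}$ for $A=\alpha e^{i\gamma}$, $B=\alpha e^{-i\gamma}$. Moreover the radii $r_0$ and $r_2$ are sharp (in the respective cases they cannot be replaced by larger numbers valid for all 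$f\in\mathcal{S}^*_{cs}(\alpha)$).
   Context: $\mathbb{D}=\{z\in\mathbb{C}:|z|<1\}$; $\mathcal{A}$ is the class of analytic functions $f$ on $\mathbb{D}$ with $f(z)=z+a_2z^2+a_3z^3+\cdots$. For analytic $f,g$ on $\mathbb{D}$, $f\prec g$ means $f=g\circ\omega$ for some Schwarz function $\omega$ (analytic on $\mathbb{D}$, $\omega(0)=0$, $|\omega|<1$). For $0<\alpha\le1$, and either $A=-B=\alpha$, or $A=\alpha e^{i\gamma}$, $B=\alpha e^{-i\gamma}$ with $0<\gamma\le\pi/2$, define $$\psi_{A,B}(z)=\frac{1}{A-B}\log\left(\frac{1+Az}{1+Bz}\right),\quad z\in\mathbb{D},$$ with the branch of the logarithm vanishing at $z=0$, and $$\mathcal{F}[A,B]=\left\{f\in\mathcal{A}:\ \frac{zf'(z)}{f(z)}-1\prec\psi_{A,B}(z)\right\}.$$ Also $$\mathcal{S}^*_{cs}(\alpha)=\left\{f\in\mathcal{A}:\ \frac{zf'(z)}{f(z)}-1\prec\frac{z}{(1-z)(1+\alpha z)}\right\}.$$ Saying that $f\in\mathcal{F}[A,B]$ for the disc of radius $\rho$ means that the rescaled function $z\mapsto f(\rho z)/\rho$ belongs to $\mathcal{F}[A,B]$; equivalently (as $\psi_{A,B}$ is univalent), $zf'(z)/f(z)-1\in\psi_{A,B}(\mathbb{D})$ for all $|z|<\rho$. Notation: $$h_1=\frac{1}{2\alpha}\log\left(\frac{1+\alpha}{1-\alpha}\right),\quad h_2=\frac{1}{2\alpha}\sin^{-1}\left(\frac{2\alpha}{1+\alpha^2}\right),$$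 $$k_1=\frac{1}{2\alpha\sin\gamma}\sin^{-1}\left(\frac{2\alpha\sin\gamma}{\sqrt{1+\alpha^4-2\alpha^2\cos2\gamma}}\right),\quad k=\frac{1}{2\alpha\sin\gamma}\tan^{-1}\left(\frac{\alpha^2\sin2\gamma}{\alpha^2\cos2\gamma-1}\right).$$
   Formalization: The smallest solution α₀ is replaced by the infimum of the solutions α in (0,1): the minimum is not attained for θ in (0,π/2), since near α≈0.6308 the solutions θ tend to 0; nonemptiness of the solution set and 0<α₀<1 are proved. *)

theory Defs
  imports "HOL-Analysis.Analysis"
begin

definition class_A :: "(complex \<Rightarrow> complex) set" where
  "class_A = {f. f holomorphic_on ball 0 1 \<and> f 0 = 0 \<and> deriv f 0 = 1}"

definition schwarz_function :: "(complex \<Rightarrow> complex) \<Rightarrow> bool" where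
  "schwarz_function \<omega> \<longleftrightarrow>
     \<omega> holomorphic_on ball 0 1 \<and> \<omega> 0 = 0 \<and> (\<forall>z\<in>ball 0 1. norm (\<omega> z) < 1)"

definition subordinate :: "(complex \<Rightarrow> complex) \<Rightarrow> (complex \<Rightarrow> complex) \<Rightarrow> bool"
    (infix "\<prec>s" 50) where
  "f \<prec>s g \<longleftrightarrow> f holomorphic_on ball 0 1 \<and> g holomorphic_on ball 0 1 \<and>
     (\<exists>\<omega>. schwarz_function \<omega> \<and> (\<forall>z\<in>ball 0 1. f z = g (\<omega> z)))"

(* The function z f'(z) / f(z), with its removable singularity at 0 filled in.  A zero of f
   elsewhere in the disc makes it non-holomorphic (z f'/f is unbounded near such a zero), so the
   holomorphy required by subordination excludes such f, as in the usual reading. *)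
definition zlogderiv :: "(complex \<Rightarrow> complex) \<Rightarrow> complex \<Rightarrow> complex" where
  "zlogderiv f z = (if z = 0 then 1 else z * deriv f z / f z)"

(* Ln is the principal logarithm; by psi_arg_not_nonpos below it is the branch on the disc that
   vanishes at z = 0. *)
definition psi :: "complex \<Rightarrow> complex \<Rightarrow> complex \<Rightarrow> complex" where
  "psi A B z = 1 / (A - B) * Ln ((1 + A * z) / (1 + B * z))"

lemma psi_arg_not_nonpos:
  fixes A B z :: complex
  assumes "norm A \<le> 1" "norm B \<le> 1" "z \<in> ball 0 1"
  shows "(1 + A * z) / (1 + B * z) \<notin> \<real>\<^sub>\<le>\<^sub>0" and "1 + B * z \<noteq> 0"
proof -
  have z: "norm z < 1" using assms(3) by simp
  have nz: "C * z \<noteq> - of_real s" if "norm C \<le> s" "0 < s" for C s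
  proof
    assume "C * z = - of_real s"
    hence "norm (C * z) = norm (complex_of_real s)" by (simp only: norm_minus_cancel)
    hence "norm C * norm z = s" using that(2) by (simp add: norm_mult)
    moreover have "norm C * norm z \<le> s * norm z" using that(1) by (simp add: mult_right_mono)
    moreover have "s * norm z < s * 1" using z that(2) by (intro mult_strict_left_mono)
    ultimately show False by simp
  qed
  show B: "1 + B * z \<noteq> 0"
  proof
    assume "1 + B * z = 0"
    hence "B * z = - of_real 1" by (simp only: of_real_1 add_eq_0_iff)
    thus False using nz[of B 1] assms(2) by simp
  qed
  show "(1 + A * z) / (1 + B * z) \<notin> \<real>\<^sub>\<le>\<^sub>0"
  proof
    assume "(1 + A * z) / (1 + B * z) \<in> \<real>\<^sub>\<le>\<^sub>0"
    then obtain u where u: "u \<le> 0" "(1 + A * z) / (1 + B * z) = of_real u"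
      by (auto simp: nonpos_Reals_def)
    define t where "t = - u"
    have t: "0 \<le> t" using u by (simp add: t_def)
    have "1 + A * z = of_real u * (1 + B * z)" using u(2) B by (simp add: divide_eq_eq)
    hence "1 + A * z + of_real t * (1 + B * z) = 0" by (simp add: t_def)
    moreover have "(A + of_real t * B) * z + of_real (1 + t) = 1 + A * z + of_real t * (1 + B * z)"
      by (simp add: ring_distribs)
    ultimately have "(A + of_real t * B) * z = - of_real (1 + t)"
      by (simp only: eq_neg_iff_add_eq_0)
    moreover have "norm (A + of_real t * B) \<le> 1 + t"
    proof -
      have "norm (A + of_real t * B) \<le> norm A + t * norm B"
        using norm_triangle_ineq[of A "of_real t * B"] t by (simp add: norm_mult)
      also have "\<dots> \<le> 1 + t" using assms t mult_left_le[of "norm B" t] by linarith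
      finally show ?thesis .
    qed
    ultimately show False using nz[of "A + of_real t * B" "1 + t"] t by simp
  qed
qed

lemma psi_0 [simp]: "psi A B 0 = 0"
  by (simp add: psi_def)

lemma holomorphic_psi:
  assumes "norm A \<le> 1" "norm B \<le> 1"
  shows "psi A B holomorphic_on ball 0 1"
  unfolding psi_def using psi_arg_not_nonpos[OF assms] by (intro holomorphic_intros) simp_all

definition class_F :: "complex \<Rightarrow> complex \<Rightarrow> (complex \<Rightarrow> complex) set" where
  "class_F A B = {f \<in> class_A. (\<lambda>z. zlogderiv f z - 1) \<prec>s psi A B}"

definition class_Scs :: "real \<Rightarrow> (complex \<Rightarrow> complex) set" where
  "class_Scs \<alpha> = {f \<in> class_A.
     (\<lambda>z. zlogderiv f z - 1) \<prec>s (\<lambda>z. z / ((1 - z) * (1 + of_real \<alpha> * z)))}"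

definition in_F_on_disc :: "complex \<Rightarrow> complex \<Rightarrow> real \<Rightarrow> (complex \<Rightarrow> complex) \<Rightarrow> bool" where
  "in_F_on_disc A B \<rho> f \<longleftrightarrow> (\<lambda>z. f (of_real \<rho> * z) / of_real \<rho>) \<in> class_F A B"

definition F_radius_valid :: "real \<Rightarrow> complex \<Rightarrow> complex \<Rightarrow> real \<Rightarrow> bool" where
  "F_radius_valid \<alpha> A B r \<longleftrightarrow> 0 < r \<and> r < 1 \<and> (\<forall>f\<in>class_Scs \<alpha>. in_F_on_disc A B r f)"

(* Functions in the class live on the unit disc only, so the larger radii are those up to 1. *)
definition F_radius_sharp :: "real \<Rightarrow> complex \<Rightarrow> complex \<Rightarrow> real \<Rightarrow> bool" where
  "F_radius_sharp \<alpha> A B r \<longleftrightarrow>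
     (\<forall>\<rho>. r < \<rho> \<and> \<rho> \<le> 1 \<longrightarrow> \<not> (\<forall>f\<in>class_Scs \<alpha>. in_F_on_disc A B \<rho> f))"

definition h1 :: "real \<Rightarrow> real" where
  "h1 \<alpha> = 1 / (2 * \<alpha>) * ln ((1 + \<alpha>) / (1 - \<alpha>))"

definition h2 :: "real \<Rightarrow> real" where
  "h2 \<alpha> = 1 / (2 * \<alpha>) * arcsin (2 * \<alpha> / (1 + \<alpha>\<^sup>2))"

definition k1 :: "real \<Rightarrow> real \<Rightarrow> real" where
  "k1 \<alpha> \<gamma> = 1 / (2 * \<alpha> * sin \<gamma>) *
     arcsin (2 * \<alpha> * sin \<gamma> / sqrt (1 + \<alpha> ^ 4 - 2 * \<alpha>\<^sup>2 * cos (2 * \<gamma>)))"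

definition k0 :: "real \<Rightarrow> real \<Rightarrow> real" where
  "k0 \<alpha> \<gamma> = 1 / (2 * \<alpha> * sin \<gamma>) *
     arctan (\<alpha>\<^sup>2 * sin (2 * \<gamma>) / (\<alpha>\<^sup>2 * cos (2 * \<gamma>) - 1))"

definition cs_radius :: "real \<Rightarrow> real \<Rightarrow> real" where
  "cs_radius \<alpha> h =
     (- (1 + (1 - \<alpha>) * h) + sqrt ((1 + (1 - \<alpha>) * h)\<^sup>2 + 4 * \<alpha> * h\<^sup>2)) / (2 * \<alpha> * h)"

definition r0 :: "real \<Rightarrow> real" where "r0 \<alpha> = cs_radius \<alpha> (h1 \<alpha>)"
definition r1 :: "real \<Rightarrow> real" where "r1 \<alpha> = cs_radius \<alpha> (h2 \<alpha>)"
definition r2 :: "real \<Rightarrow> real \<Rightarrow> real" where "r2 \<alpha> \<gamma> = cs_radius \<alpha> (k1 \<alpha> \<gamma> + k0 \<alpha> \<gamma>)"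

definition N :: "real \<Rightarrow> real \<Rightarrow> real" where
  "N \<alpha> \<theta> = (1 + (r0 \<alpha>)\<^sup>2 - 2 * r0 \<alpha> * cos \<theta>)\<^sup>2 *
             (1 + \<alpha>\<^sup>2 * (r0 \<alpha>)\<^sup>2 + 2 * \<alpha> * r0 \<alpha> * cos \<theta>)\<^sup>2"

definition alpha0_equation :: "real \<Rightarrow> real \<Rightarrow> bool" where
  "alpha0_equation \<alpha> \<theta> \<longleftrightarrow>
     (r0 \<alpha>)\<^sup>2 * ((\<alpha> - 1) * r0 \<alpha> + cos \<theta> * (1 - \<alpha> * (r0 \<alpha>)\<^sup>2))\<^sup>2 / (h1 \<alpha>)\<^sup>2
     + (r0 \<alpha>)\<^sup>2 * (1 + \<alpha> * (r0 \<alpha>)\<^sup>2)\<^sup>2 * (sin \<theta>)\<^sup>2 / (h2 \<alpha>)\<^sup>2 = N \<alpha> \<theta>"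

definition alpha0_solutions :: "real set" where
  "alpha0_solutions = {\<alpha>. 0 < \<alpha> \<and> \<alpha> < 1 \<and> (\<exists>\<theta>. 0 < \<theta> \<and> \<theta> < pi / 2 \<and> alpha0_equation \<alpha> \<theta>)}"

(* "Smallest solution" is read as the greatest lower bound of the solutions: the equation always
   holds at \<theta> = 0, and as \<alpha> decreases the solutions \<theta> in the open interval (0, pi/2) disappear
   by running into \<theta> = 0 (numerically at \<alpha> = 0.6308), so the bound need not be attained by an
   admissible \<theta>.  If a smallest solution exists, it is alpha0 (alpha0_eq_least). *)
definition alpha0 :: real where
  "alpha0 = Inf alpha0_solutions"

lemma alpha0_eq_least:
  assumes "a \<in> alpha0_solutions" "\<And>b. b \<in> alpha0_solutions \<Longrightarrow> a \<le> b"
  shows "alpha0 = a"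
  unfolding alpha0_def using assms by (intro cInf_eq_minimum)

end

theory Submission
  imports Defs "HOL-Complex_Analysis.Conformal_Mappings"
begin

text \<open>A Schwarz function maps the disc of radius \<open>r\<close> into itself, so \<open>r\<close> is valid as soon as the
  kernel \<open>\<phi>(z) = z / ((1 - z)(1 + \<alpha> z))\<close> maps that disc into the image of \<open>\<psi>\<close>, which is cut out
  of a strip by \<open>\<bar>E - 1\<bar> < \<bar>A - B E\<bar>\<close>, \<open>E = exp ((A - B) w)\<close>; sharpness is seen on the real axis
  for the function whose subordinating Schwarz function is the identity. Since
  \<open>\<bar>\<phi>(z)\<bar> \<le> \<phi>(\<bar>z\<bar>)\<close>, the radii \<open>r1\<close> and \<open>r2\<close> only need the largest disc about 0 in the image,
  and \<open>\<bar>tan u\<bar> \<le> tan \<bar>u\<bar>\<close> provides it. For \<open>r0\<close> the image contains the ellipse with semiaxes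
  \<open>h1\<close>, \<open>h2\<close>, at least when \<open>\<alpha> \<le> 4/5\<close>, which covers \<open>\<alpha> \<le> alpha0\<close>. For \<open>\<alpha> < alpha0\<close> the curve
  \<open>\<theta> \<mapsto> \<phi>(r0 exp (i \<theta>))\<close> cannot leave that ellipse: it is inside at \<open>\<theta> = \<pi>/2\<close>, does not meet the
  boundary for \<open>0 < \<theta> < \<pi>/2\<close>, and is farther inside in the left half plane. The case
  \<open>\<alpha> = alpha0\<close> follows by continuity.\<close>

section \<open>Validity and sharpness of a radius\<close>

text \<open>For real parameters \<open>h1\<close> and \<open>h2\<close> are the half-axes of the
  image of \<open>psi\<close> itself, so the ellipse touches its boundary at the vertices, and the
  equation behind \<open>alpha0\<close> says that the curve lies on the ellipse. At \<theta> = 0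
  there is contact for every \<alpha>, since the kernel takes the value \<open>h1\<close> at
  \<open>r0\<close>. Hence only a weak inequality can hold on the whole circle; strictness inside
  comes from the open mapping theorem.

  As \<open>alpha0\<close> is an infimum given only implicitly, explicit estimates bracket it: 4/5
  is a solution, which limits the range where the ellipse must be shown to fit, and no solution is
  below 1/100, which makes the infimum positive.

  The constant 2/5 is a compromise. By
  \<open>1 - 2 u / sinh (2 u) = 2/3 u^2 - 14/45 u^4 + ...\<close> and
  \<open>2 v / sin (2 v) - 1 = 2/3 v^2 + 14/45 v^4 + ...\<close> the rational bounds allow at most
  7/15, while 1 / V^2 - 1 / U^2 with U = 2 artanh \<alpha>, V = 2 arctan \<alpha> tends to 1/3 as
  \<alpha> tends to 0; 2/5 is the midpoint.\<close>

definition kphi :: "real \<Rightarrow> complex \<Rightarrow> complex" where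
  "kphi \<alpha> z = z / ((1 - z) * (1 + of_real \<alpha> * z))"

text \<open>The norm condition is |\<open>psi_inv A B w\<close>| < 1 with the denominator cleared,
  which also rules out a vanishing denominator; the strip makes \<open>Ln\<close> undo
  \<open>exp\<close>.\<close>

definition psi_region :: "complex \<Rightarrow> complex \<Rightarrow> complex set" where
  "psi_region A B = {w. \<bar>Im ((A - B) * w)\<bar> < pi \<and>
     norm (exp ((A - B) * w) - 1) < norm (A - B * exp ((A - B) * w))}"

text \<open>Solves \<open>E = (1 + A z) / (1 + B z)\<close> for z, where E =
  \<open>exp ((A - B) * w)\<close>.\<close>

definition psi_inv :: "complex \<Rightarrow> complex \<Rightarrow> complex \<Rightarrow> complex" where
  "psi_inv A B w = (exp ((A - B) * w) - 1) / (A - B * exp ((A - B) * w))"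

lemma psi_psi_inv:
  assumes "A \<noteq> B" "w \<in> psi_region A B"
  shows "A - B * exp ((A - B) * w) \<noteq> 0" "norm (psi_inv A B w) < 1" "psi A B (psi_inv A B w) = w"
proof -
  define E where "E = exp ((A - B) * w)"
  have E: "norm (E - 1) < norm (A - B * E)" and im: "\<bar>Im ((A - B) * w)\<bar> < pi"
    using assms(2) by (simp_all add: psi_region_def E_def)
  then show nz: "A - B * exp ((A - B) * w) \<noteq> 0" unfolding E_def by auto
  then have nz': "A - B * E \<noteq> 0" by (simp add: E_def)
  show "norm (psi_inv A B w) < 1"
    using E nz' by (simp add: psi_inv_def E_def[symmetric] norm_divide)
  have 1: "1 + A * psi_inv A B w = E * (A - B) / (A - B * E)"
    and 2: "1 + B * psi_inv A B w = (A - B) / (A - B * E)"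
    unfolding psi_inv_def E_def[symmetric] using nz' by (simp_all add: add_divide_eq_iff algebra_simps)
  have "(1 + A * psi_inv A B w) / (1 + B * psi_inv A B w) = exp ((A - B) * w)"
    unfolding 1 2 using nz' assms(1) by (simp add: E_def)
  moreover have "Ln (exp ((A - B) * w)) = (A - B) * w"
    using im by (intro Ln_exp) auto
  ultimately show "psi A B (psi_inv A B w) = w"
    using assms(1) by (simp add: psi_def)
qed

text \<open>For sharpness: a \<open>w\<close> that violates this inequality is not a value of
  \<open>psi\<close> on the disc. Both sides share the factor |(A - B) / (1 + B z)|, which leaves
  |z| < 1.\<close>

lemma exp_psi_bound:
  assumes "A \<noteq> B" "norm A \<le> 1" "norm B \<le> 1" "z \<in> ball 0 1" "w = psi A B z"
  shows "norm (exp ((A - B) * w) - 1) < norm (A - B * exp ((A - B) * w))"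
proof -
  note nz = psi_arg_not_nonpos[OF assms(2-4)]
  have "(1 + A * z) / (1 + B * z) \<noteq> 0" using nz(1) by auto
  then have E: "exp ((A - B) * w) = (1 + A * z) / (1 + B * z)"
    using assms(1) unfolding assms(5) psi_def by (simp add: exp_Ln)
  have 1: "exp ((A - B) * w) - 1 = (A - B) / (1 + B * z) * z"
    and 2: "A - B * exp ((A - B) * w) = (A - B) / (1 + B * z)"
    unfolding E using nz(2) by (simp_all add: field_simps)
  have "norm ((A - B) / (1 + B * z)) * norm z < norm ((A - B) / (1 + B * z)) * 1"
    using assms(1,4) nz(2) by (intro mult_strict_left_mono) (auto simp: norm_divide)
  then show ?thesis unfolding 1 2 norm_mult by simp
qed

lemma schwarz_function_norm_le:
  assumes "schwarz_function \<omega>" "norm z < 1"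
  shows "norm (\<omega> z) \<le> norm z"
  using Schwarz_Lemma[of \<omega> z] assms by (auto simp: schwarz_function_def)

lemma kphi_denom_nonzero:
  fixes z :: complex
  assumes "0 < \<alpha>" "\<alpha> < 1" "norm z < 1"
  shows "1 - z \<noteq> 0" "1 + of_real \<alpha> * z \<noteq> 0"
proof -
  show "1 - z \<noteq> 0" using assms(3) by auto
  have "norm (of_real \<alpha> * z) < 1"
    using assms mult_strict_mono[of \<alpha> 1 "norm z" 1] by (simp add: norm_mult)
  then show "1 + of_real \<alpha> * z \<noteq> 0" by (metis add_eq_0_iff norm_minus_cancel norm_one less_irrefl)
qed

lemma holomorphic_kphi:
  assumes "0 < \<alpha>" "\<alpha> < 1"
  shows "kphi \<alpha> holomorphic_on ball 0 1"
  unfolding kphi_def using kphi_denom_nonzero[OF assms] by (intro holomorphic_intros) auto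

lemma class_Scs_iff:
  "f \<in> class_Scs \<alpha> \<longleftrightarrow> f \<in> class_A \<and> (\<lambda>z. zlogderiv f z - 1) \<prec>s kphi \<alpha>"
  by (simp add: class_Scs_def kphi_def[abs_def])

lemma zlogderiv_rescale:
  assumes "f holomorphic_on ball 0 1" "0 < \<rho>" "\<rho> \<le> 1" "norm z < 1"
  shows "((\<lambda>z. f (of_real \<rho> * z) / of_real \<rho>) has_field_derivative deriv f (of_real \<rho> * z)) (at z)"
    and "zlogderiv (\<lambda>z. f (of_real \<rho> * z) / of_real \<rho>) z = zlogderiv f (of_real \<rho> * z)"
    and "norm (of_real \<rho> * z) < 1"
proof -
  have "norm (of_real \<rho> * z) = \<rho> * norm z" using assms by (simp add: norm_mult)
  also have "\<dots> \<le> 1 * norm z" using assms by (intro mult_right_mono) auto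
  finally show n: "norm (of_real \<rho> * z) < 1" using assms by simp
  have "(f has_field_derivative deriv f (of_real \<rho> * z)) (at (of_real \<rho> * z))"
    using n by (intro holomorphic_derivI[OF assms(1)]) auto
  then have "((\<lambda>z. f (of_real \<rho> * z)) has_field_derivative deriv f (of_real \<rho> * z) * of_real \<rho>) (at z)"
    by (rule DERIV_chain2) (auto intro!: derivative_eq_intros)
  from DERIV_cdivide[OF this, of "of_real \<rho>"]
  show d: "((\<lambda>z. f (of_real \<rho> * z) / of_real \<rho>) has_field_derivative deriv f (of_real \<rho> * z)) (at z)"
    using assms(2) by simp
  show "zlogderiv (\<lambda>z. f (of_real \<rho> * z) / of_real \<rho>) z = zlogderiv f (of_real \<rho> * z)"
    using DERIV_imp_deriv[OF d] assms(2) by (simp add: zlogderiv_def)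
qed

lemma F_radius_validI:
  assumes "0 < \<alpha>" "\<alpha> < 1" "0 < r" "r < 1" "A \<noteq> B" "norm A \<le> 1" "norm B \<le> 1"
    and sub: "\<And>z. norm z < r \<Longrightarrow> kphi \<alpha> z \<in> psi_region A B"
  shows "F_radius_valid \<alpha> A B r"
  unfolding F_radius_valid_def in_F_on_disc_def
proof (intro conjI ballI)
  fix f assume f: "f \<in> class_Scs \<alpha>"
  then obtain \<omega> where \<omega>: "schwarz_function \<omega>"
      "\<And>z. norm z < 1 \<Longrightarrow> zlogderiv f z - 1 = kphi \<alpha> (\<omega> z)"
    unfolding class_Scs_iff subordinate_def by auto
  have hf: "f holomorphic_on ball 0 1" "f 0 = 0" "deriv f 0 = 1"
    using f by (auto simp: class_Scs_iff class_A_def)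
  have hl: "(\<lambda>z. zlogderiv f z - 1) holomorphic_on ball 0 1"
    using f by (auto simp: class_Scs_iff subordinate_def)
  define g where "g = (\<lambda>z. f (of_real r * z) / of_real r)"
  note g = zlogderiv_rescale[OF hf(1) assms(3) less_imp_le[OF assms(4)], folded g_def]
  define p where "p z = kphi \<alpha> (\<omega> (of_real r * z))" for z
  have p: "zlogderiv g z - 1 = p z" if "norm z < 1" for z
    using g(2,3)[OF that] \<omega>(2) by (simp add: p_def)
  have holscale: "(\<lambda>z. F (of_real r * z)) holomorphic_on ball 0 1" if "F holomorphic_on ball 0 1"
    for F :: "complex \<Rightarrow> complex"
  proof -
    have "F \<circ> (\<lambda>z. of_real r * z) holomorphic_on ball 0 1"
      using that g(3) by (intro holomorphic_on_compose_gen[where t = "ball 0 1"] holomorphic_intros) auto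
    then show ?thesis by (simp add: o_def)
  qed
  \<comment> \<open>On the disc \<open>p\<close> agrees with the rescaled
    \<open>zlogderiv f - 1\<close>, whose holomorphy is part of the subordination.\<close>
  have hp: "p holomorphic_on ball 0 1"
    using holscale[OF hl] by (rule holomorphic_transform) (use g(3) \<omega>(2) in \<open>auto simp: p_def\<close>)
  have preg: "p z \<in> psi_region A B" if "norm z < 1" for z
  proof -
    have "norm (\<omega> (of_real r * z)) \<le> norm (of_real r * z)"
      by (rule schwarz_function_norm_le[OF \<omega>(1) g(3)[OF that]])
    also have "\<dots> < r" using that assms(3) by (simp add: norm_mult)
    finally show ?thesis unfolding p_def by (rule sub)
  qed
  have "g \<in> class_A"
    unfolding class_A_def
  proof (intro CollectI conjI)
    show "g holomorphic_on ball 0 1"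
      unfolding g_def using assms(3) by (intro holomorphic_intros holscale hf) auto
    show "g 0 = 0" using hf by (simp add: g_def)
    show "deriv g 0 = 1" using DERIV_imp_deriv[OF g(1)[of 0]] hf by simp
  qed
  moreover have "(\<lambda>z. zlogderiv g z - 1) \<prec>s psi A B"
    unfolding subordinate_def
  proof (intro conjI exI[of _ "\<lambda>z. psi_inv A B (p z)"] ballI)
    show "(\<lambda>z. zlogderiv g z - 1) holomorphic_on ball 0 1"
      using hp by (rule holomorphic_transform) (use p in auto)
    show "psi A B holomorphic_on ball 0 1" by (rule holomorphic_psi[OF assms(6,7)])
    show "schwarz_function (\<lambda>z. psi_inv A B (p z))"
      unfolding schwarz_function_def
    proof (intro conjI ballI)
      show "(\<lambda>z. psi_inv A B (p z)) holomorphic_on ball 0 1"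
        unfolding psi_inv_def using psi_psi_inv(1)[OF assms(5) preg]
        by (intro holomorphic_intros hp) auto
      have "\<omega> 0 = 0" using \<omega>(1) by (simp add: schwarz_function_def)
      then show "psi_inv A B (p 0) = 0" by (simp add: psi_inv_def p_def kphi_def)
    qed (use psi_psi_inv(2)[OF assms(5) preg] in auto)
  qed (use p psi_psi_inv(3)[OF assms(5) preg] in auto)
  ultimately show "(\<lambda>z. f (of_real r * z) / of_real r) \<in> class_F A B"
    unfolding class_F_def g_def by simp
qed (use assms in auto)

section \<open>The extremal function and sharpness\<close>

text \<open>The solution of z f' / f - 1 = \<open>kphi\<close>: partial fractions integrate 1 / ((1
  - z)(1 + \<alpha> z)) to this difference of logarithms over 1 + \<alpha>. Principal logarithms
  serve because 1 - z and 1 + \<alpha> z have positive real part on the disc.\<close>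

definition extremal :: "real \<Rightarrow> complex \<Rightarrow> complex" where
  "extremal \<alpha> z = z * exp ((Ln (1 + of_real \<alpha> * z) - Ln (1 - z)) / of_real (1 + \<alpha>))"

lemma one_plus_not_nonpos_Reals:
  assumes "norm (z :: complex) < 1"
  shows "1 + z \<notin> \<real>\<^sub>\<le>\<^sub>0"
proof -
  have "\<bar>Re z\<bar> < 1" using assms abs_Re_le_cmod[of z] by linarith
  then have "Re (1 + z) > 0" by simp
  then show ?thesis unfolding complex_nonpos_Reals_iff by linarith
qed

lemma extremal:
  assumes "0 < \<alpha>" "\<alpha> < 1"
  shows "extremal \<alpha> \<in> class_Scs \<alpha>"
    and "\<And>z. norm z < 1 \<Longrightarrow> zlogderiv (extremal \<alpha>) z - 1 = kphi \<alpha> z"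
proof -
  define e where "e z = exp ((Ln (1 + of_real \<alpha> * z) - Ln (1 - z)) / of_real (1 + \<alpha>))" for z :: complex
  have a1: "complex_of_real (1 + \<alpha>) \<noteq> 0" using assms by (simp only: of_real_eq_0_iff)
  have d: "(extremal \<alpha> has_field_derivative e z * (1 + kphi \<alpha> z)) (at z)" if z: "norm z < 1" for z
  proof -
    note nz = kphi_denom_nonzero[OF assms z]
    have "norm (of_real \<alpha> * z) < 1"
      using assms z mult_strict_mono[of \<alpha> 1 "norm z" 1] by (simp add: norm_mult)
    note np = one_plus_not_nonpos_Reals[OF this] one_plus_not_nonpos_Reals[of "- z", simplified, OF z]
    have "(extremal \<alpha> has_field_derivative
        e z + z * (e z * ((of_real \<alpha> / (1 + of_real \<alpha> * z) + 1 / (1 - z)) / of_real (1 + \<alpha>)))) (at z)"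
      unfolding extremal_def e_def using np nz a1
      by (auto intro!: derivative_eq_intros simp: divide_simps)
    also have "(of_real \<alpha> / (1 + of_real \<alpha> * z) + 1 / (1 - z)) / of_real (1 + \<alpha>)
        = 1 / ((1 - z) * (1 + of_real \<alpha> * z))"
    proof -
      have "of_real \<alpha> / (1 + of_real \<alpha> * z) + 1 / (1 - z)
          = of_real (1 + \<alpha>) / ((1 - z) * (1 + of_real \<alpha> * z))"
        using nz by (simp add: divide_simps) (simp add: algebra_simps)
      then show ?thesis using a1 by simp
    qed
    also have "e z + z * (e z * (1 / ((1 - z) * (1 + of_real \<alpha> * z)))) = e z * (1 + kphi \<alpha> z)"
      by (simp add: kphi_def algebra_simps)
    finally show ?thesis .
  qed
  have hol: "extremal \<alpha> holomorphic_on ball 0 1"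
    unfolding holomorphic_on_open[OF open_ball] by (metis d mem_ball_0)
  show zl: "zlogderiv (extremal \<alpha>) z - 1 = kphi \<alpha> z" if "norm z < 1" for z
  proof (cases "z = 0")
    case False
    have "extremal \<alpha> z = z * e z" by (simp add: extremal_def e_def)
    moreover have "e z \<noteq> 0" by (simp add: e_def)
    ultimately show ?thesis
      using False DERIV_imp_deriv[OF d[OF that]] by (simp add: zlogderiv_def)
  qed (simp add: zlogderiv_def kphi_def)
  have "deriv (extremal \<alpha>) 0 = 1"
    using DERIV_imp_deriv[OF d[of 0]] by (simp add: e_def kphi_def)
  then have "extremal \<alpha> \<in> class_A"
    using hol by (simp add: class_A_def) (simp add: extremal_def)
  moreover have "(\<lambda>z. zlogderiv (extremal \<alpha>) z - 1) \<prec>s kphi \<alpha>"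
    unfolding subordinate_def
  proof (intro conjI exI[of _ "\<lambda>z. z"])
    show "(\<lambda>z. zlogderiv (extremal \<alpha>) z - 1) holomorphic_on ball 0 1"
      using holomorphic_kphi[OF assms] by (rule holomorphic_transform) (use zl in auto)
  qed (use holomorphic_kphi[OF assms] zl in \<open>auto simp: schwarz_function_def intro!: holomorphic_intros\<close>)
  ultimately show "extremal \<alpha> \<in> class_Scs \<alpha>" by (simp add: class_Scs_iff)
qed

text \<open>The kernel on the real segment. After cross-multiplication the difference of the two
  sides factors as (t - s)(1 + \<alpha> s t).\<close>

lemma cs_kernel_strict_mono:
  fixes s t :: real
  assumes "0 < \<alpha>" "0 \<le> s" "s < t" "t < 1"
  shows "s / ((1 - s) * (1 + \<alpha> * s)) < t / ((1 - t) * (1 + \<alpha> * t))"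
proof -
  have "t * ((1 - s) * (1 + \<alpha> * s)) - s * ((1 - t) * (1 + \<alpha> * t)) = (t - s) * (1 + \<alpha> * s * t)"
    by algebra
  moreover have "(t - s) * (1 + \<alpha> * s * t) > 0"
    using assms by (intro mult_pos_pos add_pos_nonneg) auto
  moreover have "(1 - s) * (1 + \<alpha> * s) > 0" "(1 - t) * (1 + \<alpha> * t) > 0"
    using assms by (auto intro!: mult_pos_pos add_pos_nonneg)
  ultimately show ?thesis by (simp add: divide_simps mult.commute)
qed

text \<open>From r on the kernel increases continuously from \<open>h\<close>, so for every larger
  \<rho> some real t in (r, \<rho>) has its value in (h, h'), and \<open>extremal\<close> attains
  that value. A window (h, h') is used because for conjugate parameters
  \<open>exp ((A - B) * w)\<close> is periodic on the real axis.\<close>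

lemma F_radius_sharpI:
  assumes "0 < \<alpha>" "\<alpha> < 1" "0 < r" "r < 1" "A \<noteq> B" "norm A \<le> 1" "norm B \<le> 1"
    and h: "r / ((1 - r) * (1 + \<alpha> * r)) = h" "h < h'"
    and out: "\<And>w. h < w \<Longrightarrow> w < h' \<Longrightarrow>
      norm (A - B * exp ((A - B) * of_real w)) \<le> norm (exp ((A - B) * of_real w) - 1)"
  shows "F_radius_sharp \<alpha> A B r"
  unfolding F_radius_sharp_def
proof (intro allI impI notI)
  fix \<rho> assume \<rho>: "r < \<rho> \<and> \<rho> \<le> 1" and all: "\<forall>f\<in>class_Scs \<alpha>. in_F_on_disc A B \<rho> f"
  define q where "q t = t / ((1 - t) * (1 + \<alpha> * t))" for t
  have "isCont q r" unfolding q_def using assms by (auto intro!: continuous_intros simp: add_nonneg_eq_0_iff)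
  then have "(q \<longlongrightarrow> q r) (at_right r)"
    unfolding isCont_def by (rule filterlim_mono) (auto simp: at_within_le_at)
  then have "\<forall>\<^sub>F t in at_right r. q t < h'"
    by (rule order_tendstoD) (use h in \<open>simp add: q_def\<close>)
  moreover have "\<forall>\<^sub>F t in at_right r. t \<in> {r<..<\<rho>}"
    using \<rho> by (intro eventually_at_right_real) auto
  ultimately have "\<forall>\<^sub>F t in at_right r. q t < h' \<and> t \<in> {r<..<\<rho>}" by eventually_elim simp
  then obtain t where t: "q t < h'" "r < t" "t < \<rho>"
    using eventually_happens'[of "at_right r"] by auto
  have "h < q t"
    unfolding h(1)[symmetric] q_def using t \<rho> assms by (intro cs_kernel_strict_mono) auto
  note w = out[OF this t(1)]
  have "in_F_on_disc A B \<rho> (extremal \<alpha>)" using all extremal(1)[OF assms(1,2)] by blast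
  then obtain \<omega> where \<omega>: "schwarz_function \<omega>"
    "\<And>z. z \<in> ball 0 1 \<Longrightarrow>
      zlogderiv (\<lambda>z. extremal \<alpha> (of_real \<rho> * z) / of_real \<rho>) z - 1 = psi A B (\<omega> z)"
    unfolding in_F_on_disc_def class_F_def subordinate_def by blast
  have hol: "extremal \<alpha> holomorphic_on ball 0 1"
    using extremal(1)[OF assms(1,2)] by (auto simp: class_Scs_iff class_A_def)
  define z where "z = complex_of_real (t / \<rho>)"
  have z: "norm z < 1" using t assms \<rho> by (simp add: z_def norm_divide)
  have rz: "of_real \<rho> * z = of_real t" using \<rho> assms by (simp add: z_def)
  have "zlogderiv (\<lambda>z. extremal \<alpha> (of_real \<rho> * z) / of_real \<rho>) z = zlogderiv (extremal \<alpha>) (of_real t)"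
    using zlogderiv_rescale(2)[OF hol _ _ z, of \<rho>] \<rho> assms rz by simp
  moreover have "zlogderiv (extremal \<alpha>) (of_real t) - 1 = of_real (q t)"
    using extremal(2)[OF assms(1,2), of "of_real t"] t \<rho> assms(3) by (simp add: kphi_def q_def)
  ultimately have "of_real (q t) = psi A B (\<omega> z)" using \<omega>(2)[of z] z by simp
  moreover have "\<omega> z \<in> ball 0 1" using \<omega>(1) z by (simp add: schwarz_function_def)
  ultimately show False using exp_psi_bound[OF assms(5-7)] w by (metis linorder_not_less)
qed

section \<open>The largest disc in the image\<close>

lemma nonneg_if_deriv_nonneg:
  fixes f :: "real \<Rightarrow> real"
  assumes "0 \<le> x" "0 \<le> f 0"
    and "\<And>t. 0 \<le> t \<Longrightarrow> t \<le> x \<Longrightarrow> (f has_real_derivative f' t) (at t)"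
    and "\<And>t. 0 \<le> t \<Longrightarrow> t \<le> x \<Longrightarrow> 0 \<le> f' t"
  shows "0 \<le> f x"
  using DERIV_nonneg_imp_nondecreasing[of 0 x f] assms by fastforce

lemma sinh_le_mult_cosh:
  fixes x :: real
  assumes "0 \<le> x"
  shows "sinh x \<le> x * cosh x"
proof -
  have "0 \<le> x * cosh x - sinh x"
    using assms
    by (rule nonneg_if_deriv_nonneg[where f' = "\<lambda>t. t * sinh t"]) (auto intro!: derivative_eq_intros)
  then show ?thesis by simp
qed

lemma mult_cos_le_sin:
  fixes x :: real
  assumes "0 \<le> x" "x \<le> pi"
  shows "x * cos x \<le> sin x"
proof -
  have "0 \<le> sin x - x * cos x"
    using assms(1)
    by (rule nonneg_if_deriv_nonneg[where f' = "\<lambda>t. t * sin t"])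
       (use assms in \<open>auto intro!: derivative_eq_intros mult_nonneg_nonneg sin_ge_zero\<close>)
  then show ?thesis by simp
qed

text \<open>On the circle a^2 + b^2 = R^2 the quotient cos a / cosh b is smallest at b = 0. For
  fixed a the left side decreases in |b|, because tanh t / t \<le> 1 \<le> tan R / R.\<close>

lemma cosh_mult_cos_sqrt_le:
  fixes a b :: real
  assumes R: "sqrt (a\<^sup>2 + b\<^sup>2) \<le> pi / 2"
  shows "cosh b * cos (sqrt (a\<^sup>2 + b\<^sup>2)) \<le> cos a"
proof -
  define f where "f t = cosh t * cos (sqrt (a\<^sup>2 + t\<^sup>2))" for t
  \<comment> \<open>Monotonicity from the open interval: at t = 0 the square root is not
    differentiable when a = 0.\<close>
  have "f \<bar>b\<bar> \<le> f 0"
  proof (rule DERIV_nonpos_imp_decreasing_open[of 0 "\<bar>b\<bar>" f])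
    show "continuous_on {0..\<bar>b\<bar>} f" unfolding f_def by (intro continuous_intros)
    fix t assume t: "0 < t" "t < \<bar>b\<bar>"
    define R where "R = sqrt (a\<^sup>2 + t\<^sup>2)"
    have Rpos: "R > 0" unfolding R_def using t by (simp add: add_nonneg_pos)
    have "R \<le> sqrt (a\<^sup>2 + b\<^sup>2)"
      unfolding R_def using t power_mono[of t "\<bar>b\<bar>" 2] by simp
    then have Rle: "R \<le> pi / 2" using assms by linarith
    have d: "(f has_real_derivative sinh t * cos R - cosh t * (sin R * (t / R))) (at t)"
      unfolding f_def R_def using Rpos unfolding R_def
      by (auto intro!: derivative_eq_intros simp: field_simps)
    have "R * cos R * sinh t \<le> sin R * (t * cosh t)"
      using Rpos Rle t sinh_le_mult_cosh[of t] mult_cos_le_sin[of R]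
      by (intro mult_mono) (auto intro!: sin_ge_zero)
    then have "sinh t * cos R - cosh t * (sin R * (t / R)) \<le> 0"
      using Rpos by (simp add: field_simps)
    with d show "\<exists>y. (f has_real_derivative y) (at t) \<and> y \<le> 0" by blast
  qed simp
  then show ?thesis by (simp add: f_def)
qed

text \<open>The inequality between |tan u| and tan |u| without division. With C = cosh (2 Im u), D =
  cos (2 Re u) and \<rho> = |u|, squaring reduces it to C cos (2 \<rho>) \<le> D, which is
  \<open>cosh_mult_cos_sqrt_le\<close> at doubled arguments; hence the bound pi/4.\<close>

lemma cos_norm_mult_sin_le:
  fixes u :: complex
  assumes "norm u \<le> pi / 4"
  shows "cos (norm u) * norm (sin u) \<le> sin (norm u) * norm (cos u)"
proof (rule power2_le_imp_le)
  define \<rho> where "\<rho> = norm u"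
  define C where "C = cosh (2 * Im u)"
  define D where "D = cos (2 * Re u)"
  have C: "exp (2 * Im u) + inverse (exp (2 * Im u)) = 2 * C"
    by (simp add: C_def cosh_def exp_minus scaleR_conv_of_real)
  have s: "(norm (sin u))\<^sup>2 = (C - D) / 2"
    unfolding norm_sin_squared C by (simp add: D_def)
  have c: "(norm (cos u))\<^sup>2 = (C + D) / 2"
  proof -
    have e: "(exp (Im u) - inverse (exp (Im u)))\<^sup>2 = 2 * C - 2"
      unfolding C[symmetric] exp_double by (simp add: power2_eq_square algebra_simps)
    have "2 * (cos (Re u))\<^sup>2 = 1 + D"
      using cos_double_cos[of "Re u"] by (simp add: D_def)
    then show ?thesis unfolding norm_cos_squared e by (simp add: field_simps)
  qed
  have "sqrt ((2 * Re u)\<^sup>2 + (2 * Im u)\<^sup>2) = 2 * \<rho>"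
  proof -
    have "(2 * Re u)\<^sup>2 + (2 * Im u)\<^sup>2 = (2 * \<rho>)\<^sup>2"
      by (simp add: \<rho>_def cmod_def power_mult_distrib)
    then show ?thesis by (simp only: real_sqrt_abs) (simp add: \<rho>_def)
  qed
  then have key: "C * cos (2 * \<rho>) \<le> D"
    using cosh_mult_cos_sqrt_le[of "2 * Re u" "2 * Im u"] assms by (simp add: C_def D_def \<rho>_def)
  have 1: "(sin \<rho>)\<^sup>2 = (1 - cos (2 * \<rho>)) / 2" "(cos \<rho>)\<^sup>2 = (1 + cos (2 * \<rho>)) / 2"
    using cos_double_sin[of \<rho>] cos_double_cos[of \<rho>] by simp_all
  have "(cos \<rho> * norm (sin u))\<^sup>2 \<le> (sin \<rho> * norm (cos u))\<^sup>2"
    unfolding power_mult_distrib s c 1 using key by (simp add: field_simps)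
  then show "(cos (norm u) * norm (sin u))\<^sup>2 \<le> (sin (norm u) * norm (cos u))\<^sup>2"
    by (simp add: \<rho>_def)
  show "0 \<le> sin (norm u) * norm (cos u)"
    using assms by (intro mult_nonneg_nonneg sin_ge_zero) (auto intro: order_trans[of _ "pi/4"])
qed

section \<open>Growth of the kernel\<close>

text \<open>The closed form is the positive root of \<alpha> h r^2 + (1 + (1 - \<alpha>) h) r - h =
  0, which says, with the denominator cleared, that the kernel takes the value h at r.\<close>

lemma cs_radius:
  assumes "0 < \<alpha>" "\<alpha> < 1" "0 < h"
  shows "0 < cs_radius \<alpha> h" "cs_radius \<alpha> h < 1"
    and "h * ((1 - cs_radius \<alpha> h) * (1 + \<alpha> * cs_radius \<alpha> h)) = cs_radius \<alpha> h"
    and "cs_radius \<alpha> h / ((1 - cs_radius \<alpha> h) * (1 + \<alpha> * cs_radius \<alpha> h)) = h"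
proof -
  define b where "b = 1 + (1 - \<alpha>) * h"
  define q where "q = sqrt (b\<^sup>2 + 4 * \<alpha> * h\<^sup>2)"
  define r where "r = cs_radius \<alpha> h"
  have b: "b > 0" using assms by (simp add: b_def add_pos_nonneg)
  have q2: "q\<^sup>2 = b\<^sup>2 + 4 * \<alpha> * h\<^sup>2" using assms by (simp add: q_def)
  have ah: "\<alpha> * h > 0" using assms by simp
  have r: "2 * \<alpha> * h * r = q - b" using assms(1,3) by (simp add: r_def cs_radius_def b_def q_def)
  have qb: "q > b" unfolding q_def using assms b by (intro real_less_rsqrt) simp
  then have "0 < 2 * \<alpha> * h * r" using r by simp
  then show r0: "0 < cs_radius \<alpha> h" using ah by (simp add: zero_less_mult_iff r_def[symmetric])
  have "q < b + 2 * \<alpha> * h"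
    unfolding q_def
  proof (rule real_less_lsqrt)
    have "0 < 4 * (\<alpha> * h)" using ah by simp
    moreover have "(b + 2 * \<alpha> * h)\<^sup>2 = b\<^sup>2 + 4 * \<alpha> * h\<^sup>2 + 4 * (\<alpha> * h)"
      unfolding b_def by algebra
    ultimately show "b\<^sup>2 + 4 * \<alpha> * h\<^sup>2 < (b + 2 * \<alpha> * h)\<^sup>2" by linarith
  qed (use b ah in auto)
  then have "2 * \<alpha> * h * r < 2 * \<alpha> * h * 1" using r by simp
  then have r1: "r < 1" using assms(1,3) by (subst (asm) mult_less_cancel_left_pos) auto
  then show "cs_radius \<alpha> h < 1" by (simp add: r_def)
  have "(2 * \<alpha> * h * r + b)\<^sup>2 = b\<^sup>2 + 4 * \<alpha> * h\<^sup>2" using r q2 by simp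
  then have "(4 * (\<alpha> * h)) * (\<alpha> * h * r\<^sup>2 + b * r - h) = 0" by algebra
  then have "\<alpha> * h * r\<^sup>2 + b * r - h = 0" using assms(1,3) by (auto simp only: mult_eq_0_iff)
  then show e: "h * ((1 - cs_radius \<alpha> h) * (1 + \<alpha> * cs_radius \<alpha> h)) = cs_radius \<alpha> h"
    unfolding r_def[symmetric] b_def by algebra
  have "(1 - r) * (1 + \<alpha> * r) > 0"
    using r1 r0 assms by (intro mult_pos_pos add_pos_pos) (auto simp: r_def[symmetric])
  then show "cs_radius \<alpha> h / ((1 - cs_radius \<alpha> h) * (1 + \<alpha> * cs_radius \<alpha> h)) = h"
    using e unfolding r_def[symmetric] by (metis less_irrefl nonzero_mult_div_cancel_right)
qed

text \<open>On |z| = t the denominator has its smallest modulus at z = t: written in \<delta> = t -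
  Re z, the excess of its squared modulus over the value at \<delta> = 0 is nonnegative for 0 \<le>
  \<delta> \<le> 2 t.\<close>

lemma norm_kphi_le:
  assumes "0 < \<alpha>" "\<alpha> < 1" "norm z < 1"
  shows "norm (kphi \<alpha> z) \<le> norm z / ((1 - norm z) * (1 + \<alpha> * norm z))"
proof -
  define t where "t = norm z"
  define x where "x = Re z"
  define \<delta> where "\<delta> = t - x"
  have t: "0 \<le> t" "t < 1" using assms by (auto simp: t_def)
  have \<delta>: "0 \<le> \<delta>" "\<delta> \<le> 2 * t" using abs_Re_le_cmod[of z] by (auto simp: \<delta>_def t_def x_def)
  have t2: "(Im z)\<^sup>2 = t\<^sup>2 - x\<^sup>2" by (simp add: t_def x_def cmod_def)
  have n1: "(norm (1 - z))\<^sup>2 = (1 - t)\<^sup>2 + 2 * \<delta>"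
    unfolding cmod_power2 using t2 by (simp add: x_def[symmetric] \<delta>_def power2_eq_square algebra_simps)
  have n2: "(norm (1 + of_real \<alpha> * z))\<^sup>2 = (1 + \<alpha> * t)\<^sup>2 - 2 * \<alpha> * \<delta>"
  proof -
    have "(norm (1 + of_real \<alpha> * z))\<^sup>2 = (1 + \<alpha> * x)\<^sup>2 + \<alpha>\<^sup>2 * (Im z)\<^sup>2"
      unfolding cmod_power2 by (simp add: x_def power_mult_distrib)
    then show ?thesis unfolding t2 \<delta>_def by (simp add: power2_eq_square algebra_simps)
  qed
  have "(norm (1 - z) * norm (1 + of_real \<alpha> * z))\<^sup>2 - ((1 - t) * (1 + \<alpha> * t))\<^sup>2
      = 2 * \<delta> * ((1 - \<alpha>) * (1 - \<alpha> * t\<^sup>2)) + 4 * \<alpha> * \<delta> * (2 * t - \<delta>)"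
    unfolding power_mult_distrib n1 n2 by algebra
  moreover have "\<alpha> * t\<^sup>2 \<le> 1"
    using assms t mult_mono[of \<alpha> 1 "t\<^sup>2" 1] by (simp add: power_le_one)
  then have "0 \<le> 2 * \<delta> * ((1 - \<alpha>) * (1 - \<alpha> * t\<^sup>2)) + 4 * \<alpha> * \<delta> * (2 * t - \<delta>)"
    using \<delta> assms by (intro add_nonneg_nonneg mult_nonneg_nonneg) auto
  ultimately have "((1 - t) * (1 + \<alpha> * t))\<^sup>2 \<le> (norm (1 - z) * norm (1 + of_real \<alpha> * z))\<^sup>2"
    by linarith
  then have "(1 - t) * (1 + \<alpha> * t) \<le> norm (1 - z) * norm (1 + of_real \<alpha> * z)"
    by (rule power2_le_imp_le) simp
  moreover have "0 < (1 - t) * (1 + \<alpha> * t)"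
    using t assms by (intro mult_pos_pos add_pos_nonneg) auto
  ultimately show ?thesis
    using t by (simp add: kphi_def norm_divide norm_mult t_def[symmetric] frac_le)
qed

lemma norm_kphi_less:
  assumes "0 < \<alpha>" "\<alpha> < 1" "0 < h" "norm z < cs_radius \<alpha> h"
  shows "norm (kphi \<alpha> z) < h"
proof -
  have "norm (kphi \<alpha> z) \<le> norm z / ((1 - norm z) * (1 + \<alpha> * norm z))"
    using assms cs_radius(2)[OF assms(1-3)] by (intro norm_kphi_le) auto
  also have "\<dots> < h"
    using cs_kernel_strict_mono[of \<alpha> "norm z" "cs_radius \<alpha> h"] assms cs_radius[OF assms(1-3)] by simp
  finally show ?thesis .
qed

section \<open>The parameters on a circular arc\<close>

text \<open>Here \<open>exp ((A - B) * w)\<close> is exp (2 i u), and pulling exp (i u) out of both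
  differences leaves 2 i sin u and 2 i \<alpha> sin (\<gamma> - u).\<close>

lemma psi_region_arc_iff:
  fixes \<alpha> \<gamma> :: real and w :: complex
  assumes "0 < \<alpha>"
  defines "A \<equiv> of_real \<alpha> * exp (\<i> * of_real \<gamma>)" and "B \<equiv> of_real \<alpha> * exp (- \<i> * of_real \<gamma>)"
    and "u \<equiv> of_real (\<alpha> * sin \<gamma>) * w"
  shows "A - B = 2 * \<i> * of_real (\<alpha> * sin \<gamma>)"
    and "norm (exp ((A - B) * w) - 1) < norm (A - B * exp ((A - B) * w)) \<longleftrightarrow>
      norm (sin u) < \<alpha> * norm (sin (of_real \<gamma> - u))"
proof -
  have "exp (\<i> * of_real \<gamma>) - exp (- \<i> * of_real \<gamma>) = 2 * \<i> * complex_of_real (sin \<gamma>)"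
    using sin_exp_eq[of "complex_of_real \<gamma>"] by (simp add: sin_of_real[symmetric] field_simps)
  then show AB: "A - B = 2 * \<i> * of_real (\<alpha> * sin \<gamma>)"
    unfolding A_def B_def by (simp add: algebra_simps)
  have E: "exp ((A - B) * w) = exp (\<i> * u) * exp (\<i> * u)"
    unfolding AB u_def exp_add[symmetric] by (simp add: algebra_simps)
  have e: "exp (\<i> * u) * exp (- (\<i> * u)) = 1" by (simp add: exp_add[symmetric])
  have si: "2 * \<i> * sin v = exp (\<i> * v) - exp (- (\<i> * v))" for v by (simp add: sin_exp_eq)
  have "exp ((A - B) * w) - 1 = exp (\<i> * u) * (2 * \<i> * sin u)"
    unfolding E si using e by (simp add: algebra_simps)
  then have 1: "norm (exp ((A - B) * w) - 1) = norm (exp (\<i> * u)) * (2 * norm (sin u))"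
    by (simp add: norm_mult)
  have "A - B * exp ((A - B) * w) = of_real \<alpha> * (exp (\<i> * u) * (2 * \<i> * sin (of_real \<gamma> - u)))"
  proof -
    have "2 * \<i> * sin (of_real \<gamma> - u) = exp (\<i> * of_real \<gamma>) * exp (- (\<i> * u))
        - exp (- \<i> * of_real \<gamma>) * exp (\<i> * u)"
      unfolding si exp_add[symmetric] by (simp add: algebra_simps)
    then show ?thesis
      unfolding E unfolding A_def B_def using e by algebra
  qed
  then have 2: "norm (A - B * exp ((A - B) * w)) =
      norm (exp (\<i> * u)) * (2 * (\<alpha> * norm (sin (of_real \<gamma> - u))))"
    using assms(1) by (simp add: norm_mult)
  show "norm (exp ((A - B) * w) - 1) < norm (A - B * exp ((A - B) * w)) \<longleftrightarrow>
      norm (sin u) < \<alpha> * norm (sin (of_real \<gamma> - u))"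
    unfolding 1 2 by (simp add: mult_less_cancel_left_pos)
qed

text \<open>With \<open>A = \<alpha> exp (i \<gamma>)\<close>, the angle \<open>\<beta>\<close> is the argument of \<open>1 + A\<close>, and the closed form rests on
  \<open>(1 - \<alpha>\<^sup>2 + 2 i \<alpha> sin \<gamma>) (1 - A\<^sup>2) = \<bar>1 - A\<bar>\<^sup>2 (1 + A)\<^sup>2\<close>.\<close>

lemma arc_extent:
  assumes \<alpha>: "0 < \<alpha>" "\<alpha> < 1" and \<gamma>: "0 < \<gamma>" "\<gamma> \<le> pi / 2"
  defines "\<beta> \<equiv> arctan (\<alpha> * sin \<gamma> / (1 + \<alpha> * cos \<gamma>))"
  shows "0 < \<beta>" "2 * \<beta> < \<gamma>" "sin \<beta> = \<alpha> * sin (\<gamma> - \<beta>)"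
    and "k1 \<alpha> \<gamma> + k0 \<alpha> \<gamma> = \<beta> / (\<alpha> * sin \<gamma>)"
proof -
  define s where "s = sin \<gamma>"
  define c where "c = cos \<gamma>"
  have s: "s > 0" unfolding s_def using \<gamma> by (intro sin_gt_zero) auto
  have c: "c \<ge> 0" unfolding c_def using \<gamma> by (intro cos_ge_zero) auto
  have sc: "s\<^sup>2 + c\<^sup>2 = 1" by (simp add: s_def c_def)
  define d where "d = 1 + \<alpha> * c"
  have d: "d \<ge> 1" using c \<alpha> by (simp add: d_def)
  \<comment> \<open>The modulus of 1 + A, whose real and imaginary parts are \<open>d\<close> and
    \<alpha> s.\<close>
  define m where "m = sqrt (d\<^sup>2 + (\<alpha> * s)\<^sup>2)"
  have m: "m > 0" "m\<^sup>2 = d\<^sup>2 + (\<alpha> * s)\<^sup>2" using d by (simp_all add: m_def add_pos_nonneg)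
  have "1 + (\<alpha> * s / d)\<^sup>2 = (m / d)\<^sup>2" using m(2) d by (simp add: power_divide field_simps)
  then have "sqrt (1 + (\<alpha> * s / d)\<^sup>2) = m / d" using m d by simp
  then have sb: "sin \<beta> = \<alpha> * s / m" and cb: "cos \<beta> = d / m"
    unfolding \<beta>_def s_def[symmetric] c_def[symmetric] d_def[symmetric] sin_arctan cos_arctan
    using d m by simp_all
  show b0: "0 < \<beta>"
    unfolding \<beta>_def s_def[symmetric] c_def[symmetric] d_def[symmetric] using \<alpha> s d by simp
  have b1: "\<beta> < pi / 2" unfolding \<beta>_def by (rule arctan_ubound)
  have "sin (\<gamma> - \<beta>) = s / m"
    unfolding sin_diff sb cb s_def[symmetric] c_def[symmetric] d_def using m(1) by (simp add: field_simps)
  \<comment> \<open>The real point u = \<beta> lies on the boundary |sin u| = \<alpha> |sin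
    (\<gamma> - u)|.\<close>
  then show sb': "sin \<beta> = \<alpha> * sin (\<gamma> - \<beta>)" by (simp add: sb)
  have "sin (\<gamma> - \<beta>) > 0" using \<open>sin (\<gamma> - \<beta>) = s / m\<close> s m by simp
  then have "sin \<beta> < sin (\<gamma> - \<beta>)" unfolding sb' using \<alpha> by simp
  then have "\<beta> < \<gamma> - \<beta>"
    using b0 b1 \<gamma> by (subst (asm) sin_mono_less_eq) auto
  then show b2: "2 * \<beta> < \<gamma>" by simp
  define Q where "Q = sqrt (1 + \<alpha> ^ 4 - 2 * \<alpha>\<^sup>2 * cos (2 * \<gamma>))"
  have c2: "cos (2 * \<gamma>) = 1 - 2 * s\<^sup>2" "sin (2 * \<gamma>) = 2 * s * c"
    by (simp_all add: cos_double_sin sin_double s_def c_def)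
  have Q2': "1 + \<alpha> ^ 4 - 2 * \<alpha>\<^sup>2 * cos (2 * \<gamma>) = (1 - \<alpha>\<^sup>2)\<^sup>2 + (2 * \<alpha> * s)\<^sup>2"
    unfolding c2 by algebra
  have a2: "\<alpha>\<^sup>2 < 1" using \<alpha> by (simp add: power_less_one_iff)
  have Q: "Q > 0" "Q\<^sup>2 = (1 - \<alpha>\<^sup>2)\<^sup>2 + (2 * \<alpha> * s)\<^sup>2"
    using a2 unfolding Q_def Q2' by (simp_all add: add_pos_nonneg)
  \<comment> \<open>\<open>p\<close> and \<open>q\<close> are the arguments of 1 - \<alpha>^2 + 2 i
    \<alpha> s and of 1 - A^2 = e - i g, with \<open>e\<close> and \<open>g\<close> as below; both
    numbers have modulus \<open>Q\<close>.\<close>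
  define p where "p = arcsin (2 * \<alpha> * s / Q)"
  define q where "q = arctan (\<alpha>\<^sup>2 * sin (2 * \<gamma>) / (\<alpha>\<^sup>2 * cos (2 * \<gamma>) - 1))"
  have le: "2 * \<alpha> * s \<le> Q"
    by (rule power2_le_imp_le) (use Q in simp_all)
  have r01: "0 \<le> 2 * \<alpha> * s / Q" "2 * \<alpha> * s / Q \<le> 1" using le Q(1) \<alpha> s by simp_all
  have p: "0 \<le> p" "p \<le> pi / 2" "sin p = 2 * \<alpha> * s / Q"
  proof -
    show "sin p = 2 * \<alpha> * s / Q" "p \<le> pi / 2"
      unfolding p_def using r01 by (intro sin_arcsin arcsin_ubound; linarith)+
    have "arcsin 0 \<le> p" unfolding p_def using r01 by (intro arcsin_le_arcsin) linarith+
    then show "0 \<le> p" by simp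
  qed
  have "cos p = sqrt (1 - (2 * \<alpha> * s / Q)\<^sup>2)"
    unfolding p_def using r01 by (intro cos_arcsin) auto
  also have "1 - (2 * \<alpha> * s / Q)\<^sup>2 = ((1 - \<alpha>\<^sup>2) / Q)\<^sup>2"
  proof -
    have "(2 * \<alpha> * s)\<^sup>2 = Q\<^sup>2 - (1 - \<alpha>\<^sup>2)\<^sup>2" using Q(2) by simp
    then show ?thesis unfolding power_divide using Q(1) by (simp add: diff_divide_distrib)
  qed
  finally have cp: "cos p = (1 - \<alpha>\<^sup>2) / Q" using a2 Q(1) by simp
  define e where "e = 1 - \<alpha>\<^sup>2 * cos (2 * \<gamma>)"
  have "\<alpha>\<^sup>2 * cos (2 * \<gamma>) \<le> \<alpha>\<^sup>2 * 1" by (intro mult_left_mono) auto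
  then have e: "e > 0" using a2 by (simp add: e_def)
  define g where "g = \<alpha>\<^sup>2 * sin (2 * \<gamma>)"
  have g: "g \<ge> 0" unfolding g_def c2 using s c by simp
  have Qeg: "Q\<^sup>2 = e\<^sup>2 + g\<^sup>2" unfolding Q(2) e_def g_def c2 using sc by algebra
  have q': "q = - arctan (g / e)"
  proof -
    have "g / (\<alpha>\<^sup>2 * cos (2 * \<gamma>) - 1) = - (g / e)" using e by (simp add: e_def divide_simps) (simp add: algebra_simps)
    then show ?thesis unfolding q_def g_def[symmetric] by (simp add: arctan_minus)
  qed
  have "1 + (g / e)\<^sup>2 = (Q / e)\<^sup>2" using e Qeg by (simp add: power_divide field_simps)
  then have "sqrt (1 + (g / e)\<^sup>2) = Q / e" using e Q by simp
  then have sq: "sin q = - g / Q" and cq: "cos q = e / Q"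
    unfolding q' using e Q by (simp_all add: sin_arctan cos_arctan)
  have q: "- pi / 2 < q" "q \<le> 0"
    unfolding q' using arctan_ubound[of "g / e"] g e by (auto simp: arctan_less_zero_iff not_less)
  have "sin (p + q) = (2 * \<alpha> * s * e - (1 - \<alpha>\<^sup>2) * g) / Q\<^sup>2"
    unfolding sin_add sq cq cp p(3) using Q by (simp add: field_simps power2_eq_square)
  also have "\<dots> = 2 * (\<alpha> * s * d) / m\<^sup>2"
  proof -
    have "(2 * \<alpha> * s * e - (1 - \<alpha>\<^sup>2) * g) * m\<^sup>2 = 2 * (\<alpha> * s * d) * Q\<^sup>2"
      unfolding m(2) Q(2) e_def g_def c2 d_def using sc by algebra
    then show ?thesis using m(1) Q(1) by (simp add: field_simps)
  qed
  also have "\<dots> = sin (2 * \<beta>)" unfolding sin_double sb cb by (simp add: power2_eq_square)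
  \<comment> \<open>The sines determine the angles: p + q and 2 \<beta> both lie in [-pi/2, pi/2],
    the latter by 2 \<beta> < \<gamma>.\<close>
  finally have "arcsin (sin (p + q)) = arcsin (sin (2 * \<beta>))" by simp
  moreover have "arcsin (sin (p + q)) = p + q"
    using p(1,2) q by (intro arcsin_sin) linarith+
  moreover have "arcsin (sin (2 * \<beta>)) = 2 * \<beta>"
    using b0 b2 \<gamma> by (intro arcsin_sin) linarith+
  ultimately have "p + q = 2 * \<beta>" by simp
  moreover have "k1 \<alpha> \<gamma> + k0 \<alpha> \<gamma> = (p + q) / (2 * (\<alpha> * s))"
    unfolding k1_def k0_def s_def[symmetric] Q_def[symmetric] p_def[symmetric] q_def[symmetric]
    by (simp add: add_divide_distrib mult.assoc)
  ultimately show "k1 \<alpha> \<gamma> + k0 \<alpha> \<gamma> = \<beta> / (\<alpha> * sin \<gamma>)" by (simp add: s_def)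
qed

text \<open>Since sin (\<gamma> - u) / sin u = sin \<gamma> cot u - cos \<gamma> with cos \<gamma>
  \<ge> 0, the triangle inequality and |cot u| \<ge> cot |u| bound the modulus of this quotient
  below by sin (\<gamma> - \<rho>) / sin \<rho>, \<rho> = |u|, which exceeds 1 / \<alpha> for \<rho>
  < \<beta>. The proof multiplies out, so that u = 0 is covered.\<close>

lemma ball_subset_psi_region_arc:
  assumes \<alpha>: "0 < \<alpha>" "\<alpha> < 1" and \<gamma>: "0 < \<gamma>" "\<gamma> \<le> pi / 2"
    and w: "norm w < k1 \<alpha> \<gamma> + k0 \<alpha> \<gamma>"
  shows "w \<in> psi_region (of_real \<alpha> * exp (\<i> * of_real \<gamma>)) (of_real \<alpha> * exp (- \<i> * of_real \<gamma>))"
proof -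
  define \<beta> where "\<beta> = arctan (\<alpha> * sin \<gamma> / (1 + \<alpha> * cos \<gamma>))"
  note \<beta> = arc_extent[OF assms(1-4), folded \<beta>_def]
  define u where "u = of_real (\<alpha> * sin \<gamma>) * w"
  define \<rho> where "\<rho> = norm u"
  have s: "sin \<gamma> > 0" using \<gamma> by (intro sin_gt_zero) auto
  have c: "cos \<gamma> \<ge> 0" using \<gamma> by (intro cos_ge_zero) auto
  have \<rho>': "\<rho> = \<alpha> * sin \<gamma> * norm w" using \<alpha> s by (simp add: \<rho>_def u_def norm_mult)
  have \<rho>: "0 \<le> \<rho>" "\<rho> < \<beta>"
    using w \<alpha> s unfolding \<beta>(4) by (simp_all add: \<rho>' field_simps)
  have "sin \<rho> < sin \<beta>" using \<rho> \<beta>(1,2) \<gamma> by (intro sin_monotone_2pi) auto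
  also have "\<dots> \<le> \<alpha> * sin (\<gamma> - \<rho>)"
    unfolding \<beta>(3) using \<rho> \<beta>(1,2) \<gamma> \<alpha> by (intro mult_left_mono sin_monotone_2pi_le) auto
  finally have lt: "sin \<rho> < \<alpha> * sin (\<gamma> - \<rho>)" .
  have s\<rho>: "sin \<rho> \<ge> 0" using \<rho> \<beta> \<gamma> by (intro sin_ge_zero) auto
  have pos: "sin (\<gamma> - \<rho>) > 0" using \<rho> \<beta> \<gamma> by (intro sin_gt_zero) auto
  have key: "cos \<rho> * norm (sin u) \<le> sin \<rho> * norm (cos u)"
    unfolding \<rho>_def using \<rho> \<beta> \<gamma> by (intro cos_norm_mult_sin_le) (auto simp: \<rho>_def)
  have "norm (sin \<gamma> * cos u) - norm (cos \<gamma> * sin u) \<le> norm (sin (of_real \<gamma> - u))"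
    unfolding sin_diff by (metis norm_triangle_ineq2 cos_of_real sin_of_real)
  then have tri: "sin \<gamma> * norm (cos u) - cos \<gamma> * norm (sin u) \<le> norm (sin (of_real \<gamma> - u))"
    using s c by (simp add: norm_mult)
  have "norm (sin u) * sin (\<gamma> - \<rho>)
      = sin \<gamma> * (cos \<rho> * norm (sin u)) - sin \<rho> * cos \<gamma> * norm (sin u)"
    by (simp add: sin_diff algebra_simps)
  also have "\<dots> \<le> sin \<gamma> * (sin \<rho> * norm (cos u)) - sin \<rho> * cos \<gamma> * norm (sin u)"
    using key s by simp
  also have "\<dots> = sin \<rho> * (sin \<gamma> * norm (cos u) - cos \<gamma> * norm (sin u))" by (simp add: algebra_simps)
  also have "\<dots> \<le> sin \<rho> * norm (sin (of_real \<gamma> - u))" using tri s\<rho> by (rule mult_left_mono)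
  finally have le: "norm (sin u) * sin (\<gamma> - \<rho>) \<le> sin \<rho> * norm (sin (of_real \<gamma> - u))" .
  have "Im (sin (complex_of_real \<gamma> - u)) \<noteq> 0 \<or> Re (sin (complex_of_real \<gamma> - u)) \<noteq> 0"
  proof -
    have "\<bar>Re u\<bar> \<le> \<rho>" unfolding \<rho>_def by (rule abs_Re_le_cmod)
    then have "sin (\<gamma> - Re u) > 0" using \<rho> \<beta>(1,2) \<gamma> by (intro sin_gt_zero) auto
    then show ?thesis by (simp add: Re_sin add_pos_pos less_imp_neq[symmetric])
  qed
  then have "norm (sin (of_real \<gamma> - u)) > 0" by auto
  then have "sin \<rho> * norm (sin (of_real \<gamma> - u)) < \<alpha> * sin (\<gamma> - \<rho>) * norm (sin (of_real \<gamma> - u))"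
    using lt by (intro mult_strict_right_mono)
  with le have "norm (sin u) * sin (\<gamma> - \<rho>) < \<alpha> * norm (sin (of_real \<gamma> - u)) * sin (\<gamma> - \<rho>)"
    by (simp add: mult_ac)
  then have "norm (sin u) < \<alpha> * norm (sin (of_real \<gamma> - u))" using pos by simp
  moreover have "\<bar>Im (2 * \<i> * of_real (\<alpha> * sin \<gamma>) * w)\<bar> < pi"
  proof -
    have "Im (2 * \<i> * of_real (\<alpha> * sin \<gamma>) * w) = 2 * Re u"
      unfolding u_def by simp
    then show ?thesis using abs_Re_le_cmod[of u] \<rho> \<beta>(1,2) \<gamma> by (simp add: \<rho>_def)
  qed
  ultimately show ?thesis
    unfolding psi_region_def mem_Collect_eq
      psi_region_arc_iff(2)[OF \<alpha>(1)]
    unfolding psi_region_arc_iff(1)[OF \<alpha>(1)] u_def by blast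
qed

lemma arc_radius:
  assumes \<alpha>: "0 < \<alpha>" "\<alpha> < 1" and \<gamma>: "0 < \<gamma>" "\<gamma> \<le> pi / 2"
  defines "A \<equiv> of_real \<alpha> * exp (\<i> * of_real \<gamma>)" and "B \<equiv> of_real \<alpha> * exp (- \<i> * of_real \<gamma>)"
  shows "F_radius_valid \<alpha> A B (r2 \<alpha> \<gamma>)" "F_radius_sharp \<alpha> A B (r2 \<alpha> \<gamma>)"
proof -
  define \<beta> where "\<beta> = arctan (\<alpha> * sin \<gamma> / (1 + \<alpha> * cos \<gamma>))"
  note \<beta> = arc_extent[OF assms(1-4), folded \<beta>_def]
  define h where "h = k1 \<alpha> \<gamma> + k0 \<alpha> \<gamma>"
  have s: "\<alpha> * sin \<gamma> > 0" using \<alpha> \<gamma> by (intro mult_pos_pos sin_gt_zero) auto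
  have h: "h > 0" unfolding h_def \<beta>(4) using s \<beta>(1) by simp
  have "A - B \<noteq> 0" unfolding A_def B_def psi_region_arc_iff(1)[OF \<alpha>(1)] using s by auto
  then have AB: "A \<noteq> B" by simp
  have n: "norm A \<le> 1" "norm B \<le> 1" using \<alpha> by (simp_all add: A_def B_def norm_mult)
  note r = cs_radius[OF \<alpha> h]
  show "F_radius_valid \<alpha> A B (r2 \<alpha> \<gamma>)"
    unfolding r2_def h_def[symmetric]
  proof (rule F_radius_validI[OF \<alpha> r(1,2) AB n])
    fix z :: complex assume "norm z < cs_radius \<alpha> h"
    then show "kphi \<alpha> z \<in> psi_region A B"
      unfolding A_def B_def
      by (intro ball_subset_psi_region_arc[OF assms(1-4)] norm_kphi_less[OF \<alpha>]) (use h in \<open>simp_all add: h_def\<close>)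
  qed
  show "F_radius_sharp \<alpha> A B (r2 \<alpha> \<gamma>)"
    unfolding r2_def h_def[symmetric]
  proof (rule F_radius_sharpI[OF \<alpha> r(1,2) AB n r(4)])
    \<comment> \<open>In u = \<alpha> sin \<gamma> w the window is (\<beta>, \<gamma>), where both
      sines are nonnegative and monotone.\<close>
    show "h < \<gamma> / (\<alpha> * sin \<gamma>)"
      unfolding h_def \<beta>(4) using s \<beta>(1,2) by (intro divide_strict_right_mono) auto
    fix w assume w: "h < w" "w < \<gamma> / (\<alpha> * sin \<gamma>)"
    define u where "u = \<alpha> * sin \<gamma> * w"
    have u: "\<beta> < u" "u < \<gamma>"
      using w s unfolding h_def \<beta>(4) u_def by (simp_all add: field_simps)
    have "\<alpha> * sin (\<gamma> - u) \<le> \<alpha> * sin (\<gamma> - \<beta>)"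
      using u \<beta>(1,2) \<gamma> \<alpha> by (intro mult_left_mono sin_monotone_2pi_le) auto
    also have "\<dots> \<le> sin u"
      unfolding \<beta>(3)[symmetric] using u \<beta>(1,2) \<gamma> by (intro sin_monotone_2pi_le) auto
    finally have "\<not> sin u < \<alpha> * sin (\<gamma> - u)" by simp
    moreover have "sin u \<ge> 0" "sin (\<gamma> - u) \<ge> 0" using u \<beta> \<gamma> by (auto intro!: sin_ge_zero)
    moreover have "of_real (\<alpha> * sin \<gamma>) * complex_of_real w = of_real u"
      "of_real \<gamma> - complex_of_real u = of_real (\<gamma> - u)" by (simp_all add: u_def)
    ultimately have "\<not> norm (exp ((A - B) * of_real w) - 1) < norm (A - B * exp ((A - B) * of_real w))"
      unfolding A_def B_def psi_region_arc_iff(2)[OF \<alpha>(1)]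
      by (simp only: sin_of_real norm_of_real abs_of_nonneg not_False_eq_True)
    then show "norm (A - B * exp ((A - B) * of_real w)) \<le> norm (exp ((A - B) * of_real w) - 1)"
      by simp
  qed
qed

section \<open>The real parameters\<close>

text \<open>Squaring the norms and dividing by 2 x, where x = |E|, produces cosh and cos. The form
  \<open>of_real \<alpha> - - of_real \<alpha>\<close> is the literal instance of A - B at B =
  -\<alpha>, so that the lemma rewrites the unfolded \<open>psi_region\<close>.\<close>

lemma psi_region_real_iff:
  fixes w :: complex
  assumes "0 < \<alpha>" "\<alpha> < 1"
  shows "norm (exp ((of_real \<alpha> - - of_real \<alpha>) * w) - 1) <
      norm (of_real \<alpha> - - of_real \<alpha> * exp ((of_real \<alpha> - - of_real \<alpha>) * w)) \<longleftrightarrow>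
    (1 - \<alpha>\<^sup>2) * cosh (2 * \<alpha> * Re w) < (1 + \<alpha>\<^sup>2) * cos (2 * \<alpha> * Im w)"
proof -
  define x where "x = exp (2 * \<alpha> * Re w)"
  define c where "c = cos (2 * \<alpha> * Im w)"
  define s where "s = sin (2 * \<alpha> * Im w)"
  define E where "E = exp ((of_real \<alpha> - - of_real \<alpha>) * w)"
  have x: "x > 0" by (simp add: x_def)
  have cs: "c\<^sup>2 + s\<^sup>2 = 1" by (simp add: c_def s_def)
  have ReIm: "Re E = x * c" "Im E = x * s"
    by (simp_all add: E_def x_def c_def s_def Re_exp Im_exp)
  have 1: "(norm (E - 1))\<^sup>2 = x\<^sup>2 + 1 - 2 * x * c"
  proof -
    have "(norm (E - 1))\<^sup>2 = (x * c - 1)\<^sup>2 + (x * s)\<^sup>2" unfolding cmod_power2 by (simp add: ReIm)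
    also have "\<dots> = x\<^sup>2 + 1 - 2 * x * c" using cs by algebra
    finally show ?thesis .
  qed
  have 2: "(norm (of_real \<alpha> - - of_real \<alpha> * E))\<^sup>2 = \<alpha>\<^sup>2 * (x\<^sup>2 + 1 + 2 * x * c)"
  proof -
    have "(norm (of_real \<alpha> - - of_real \<alpha> * E))\<^sup>2 = (\<alpha> + \<alpha> * (x * c))\<^sup>2 + (\<alpha> * (x * s))\<^sup>2"
      unfolding cmod_power2 by (simp add: ReIm)
    also have "\<dots> = \<alpha>\<^sup>2 * (x\<^sup>2 + 1 + 2 * x * c)" using cs by algebra
    finally show ?thesis .
  qed
  have ch: "2 * x * cosh (2 * \<alpha> * Re w) = x\<^sup>2 + 1"
    by (simp add: cosh_def x_def exp_minus power2_eq_square field_simps)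
  have "norm (E - 1) < norm (of_real \<alpha> - - of_real \<alpha> * E) \<longleftrightarrow>
      (norm (E - 1))\<^sup>2 < (norm (of_real \<alpha> - - of_real \<alpha> * E))\<^sup>2"
    by (meson norm_ge_zero power_strict_mono power_less_imp_less_base zero_less_numeral)
  also have "\<dots> \<longleftrightarrow> (1 - \<alpha>\<^sup>2) * (x\<^sup>2 + 1) < (1 + \<alpha>\<^sup>2) * (2 * x * c)"
    unfolding 1 2 by (simp add: algebra_simps)
  also have "\<dots> \<longleftrightarrow> 2 * x * ((1 - \<alpha>\<^sup>2) * cosh (2 * \<alpha> * Re w)) < 2 * x * ((1 + \<alpha>\<^sup>2) * c)"
    unfolding ch[symmetric] by (simp only: mult_ac)
  also have "\<dots> \<longleftrightarrow> (1 - \<alpha>\<^sup>2) * cosh (2 * \<alpha> * Re w) < (1 + \<alpha>\<^sup>2) * c"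
    using x by (intro mult_less_cancel_left_pos) simp
  finally show ?thesis by (simp only: E_def c_def)
qed

lemma h1_eq: "h1 \<alpha> = artanh \<alpha> / \<alpha>"
  by (simp add: h1_def artanh_def)

text \<open>By \<open>psi_region_real_iff\<close> this puts \<open>h1\<close> on the boundary of the
  image; the cosine in \<open>sin_cos_double_arctan\<close> does the same for i
  \<open>h2\<close>.\<close>

lemma cosh_double_artanh:
  fixes \<alpha> :: real
  assumes "0 < \<alpha>" "\<alpha> < 1"
  shows "(1 - \<alpha>\<^sup>2) * cosh (2 * artanh \<alpha>) = 1 + \<alpha>\<^sup>2"
proof -
  have e: "exp (2 * artanh \<alpha>) = (1 + \<alpha>) / (1 - \<alpha>)"
    using assms by (simp add: artanh_def)
  have f: "1 - \<alpha>\<^sup>2 = (1 - \<alpha>) * (1 + \<alpha>)" by (simp add: power2_eq_square algebra_simps)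
  have 1: "(1 - \<alpha>\<^sup>2) * ((1 + \<alpha>) / (1 - \<alpha>)) = (1 + \<alpha>)\<^sup>2"
    and 2: "(1 - \<alpha>\<^sup>2) * inverse ((1 + \<alpha>) / (1 - \<alpha>)) = (1 - \<alpha>)\<^sup>2"
    unfolding f using assms by (simp_all add: power2_eq_square)
  define X where "X = (1 + \<alpha>) / (1 - \<alpha>)"
  have "(1 - \<alpha>\<^sup>2) * cosh (2 * artanh \<alpha>) = ((1 - \<alpha>\<^sup>2) * X + (1 - \<alpha>\<^sup>2) * inverse X) / 2"
    unfolding cosh_def exp_minus e X_def[symmetric] by (simp add: algebra_simps)
  then show "(1 - \<alpha>\<^sup>2) * cosh (2 * artanh \<alpha>) = 1 + \<alpha>\<^sup>2"
    unfolding X_def 1 2 by (simp add: power2_eq_square algebra_simps)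
qed

lemma sin_cos_double_arctan:
  fixes x :: real
  shows "sin (2 * arctan x) = 2 * x / (1 + x\<^sup>2)" "cos (2 * arctan x) = (1 - x\<^sup>2) / (1 + x\<^sup>2)"
proof -
  have p: "1 + x\<^sup>2 > 0" by (simp add: add_pos_nonneg)
  then have "sqrt (1 + x\<^sup>2) * sqrt (1 + x\<^sup>2) = 1 + x\<^sup>2" by simp
  then show "sin (2 * arctan x) = 2 * x / (1 + x\<^sup>2)"
    by (simp add: sin_double sin_arctan cos_arctan)
  have "(cos (arctan x))\<^sup>2 = 1 / (1 + x\<^sup>2)" "(sin (arctan x))\<^sup>2 = x\<^sup>2 / (1 + x\<^sup>2)"
    using p by (simp_all add: cos_arctan sin_arctan power_divide)
  then show "cos (2 * arctan x) = (1 - x\<^sup>2) / (1 + x\<^sup>2)"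
    by (simp add: cos_double diff_divide_distrib)
qed

lemma arctan_less_pi4:
  assumes "x < 1"
  shows "arctan x < pi / 4"
  using assms arctan_less_iff[of x 1] by (simp add: arctan_one)

lemma h2_eq:
  assumes "0 < \<alpha>" "\<alpha> < 1"
  shows "h2 \<alpha> = arctan \<alpha> / \<alpha>"
proof -
  have "arcsin (sin (2 * arctan \<alpha>)) = 2 * arctan \<alpha>"
    using arctan_less_pi4[OF assms(2)] zero_less_arctan_iff[of \<alpha>] assms(1)
    by (intro arcsin_sin) linarith+
  then show ?thesis unfolding h2_def sin_cos_double_arctan by simp
qed

lemma h1_h2_pos:
  assumes "0 < \<alpha>" "\<alpha> < 1"
  shows "0 < h1 \<alpha>" "0 < h2 \<alpha>"
  using assms by (auto simp: h1_def h2_eq intro!: mult_pos_pos divide_pos_pos)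

lemma F_radius_sharp_r0:
  assumes "0 < \<alpha>" "\<alpha> < 1"
  shows "F_radius_sharp \<alpha> (of_real \<alpha>) (- of_real \<alpha>) (r0 \<alpha>)"
proof -
  note r = cs_radius[OF assms h1_h2_pos(1)[OF assms]]
  show ?thesis
    unfolding r0_def
  proof (rule F_radius_sharpI[OF assms r(1,2) _ _ _ r(4)])
    \<comment> \<open>All real points beyond \<open>h1\<close> are outside, so the upper end of the
      window is arbitrary.\<close>
    show "h1 \<alpha> < h1 \<alpha> + 1" by simp
    fix w assume w: "h1 \<alpha> < w"
    have "(1 + \<alpha>\<^sup>2) * 1 = (1 - \<alpha>\<^sup>2) * cosh (2 * \<alpha> * h1 \<alpha>)"
      using cosh_double_artanh[OF assms] assms by (simp add: h1_eq mult.assoc)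
    also have "\<dots> \<le> (1 - \<alpha>\<^sup>2) * cosh (2 * \<alpha> * w)"
      using w assms h1_h2_pos[OF assms]
      by (intro mult_left_mono) (auto simp: cosh_real_nonneg_le_iff power_le_one)
    finally show "norm (of_real \<alpha> - - of_real \<alpha> * exp ((of_real \<alpha> - - of_real \<alpha>) * complex_of_real w))
        \<le> norm (exp ((of_real \<alpha> - - of_real \<alpha>) * complex_of_real w) - 1)"
      using psi_region_real_iff[OF assms, of "of_real w"] by (simp add: not_less)
  qed (use assms in auto)
qed

lemma F_radius_valid_real:
  assumes \<alpha>: "0 < \<alpha>" "\<alpha> < 1" and r: "0 < r" "r < 1"
    and "\<And>z. norm z < r \<Longrightarrow> 2 * \<alpha> * \<bar>Im (kphi \<alpha> z)\<bar> < pi \<and>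
      (1 - \<alpha>\<^sup>2) * cosh (2 * \<alpha> * Re (kphi \<alpha> z)) < (1 + \<alpha>\<^sup>2) * cos (2 * \<alpha> * Im (kphi \<alpha> z))"
  shows "F_radius_valid \<alpha> (of_real \<alpha>) (- of_real \<alpha>) r"
proof (rule F_radius_validI[OF \<alpha> r])
  fix z :: complex assume z: "norm z < r"
  have "\<bar>Im ((of_real \<alpha> - - of_real \<alpha>) * kphi \<alpha> z)\<bar> = 2 * \<alpha> * \<bar>Im (kphi \<alpha> z)\<bar>"
    using \<alpha> by (simp add: abs_mult)
  then show "kphi \<alpha> z \<in> psi_region (of_real \<alpha>) (- of_real \<alpha>)"
    unfolding psi_region_def mem_Collect_eq psi_region_real_iff[OF \<alpha>] using assms(5)[OF z] by simp
qed (use \<alpha> in auto)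

text \<open>The disc |w| < \<open>h2\<close> lies in the image:
  \<open>cosh_mult_cos_sqrt_le\<close>, with the imaginary part as \<open>a\<close>, shows that the
  worst points of each circle about 0 are on the imaginary axis.\<close>

lemma F_radius_valid_r1:
  assumes \<alpha>: "0 < \<alpha>" "\<alpha> < 1"
  shows "F_radius_valid \<alpha> (of_real \<alpha>) (- of_real \<alpha>) (r1 \<alpha>)"
  unfolding r1_def
proof (rule F_radius_valid_real[OF \<alpha>])
  note h2 = h1_h2_pos(2)[OF \<alpha>]
  show "0 < cs_radius \<alpha> (h2 \<alpha>)" "cs_radius \<alpha> (h2 \<alpha>) < 1" by (rule cs_radius[OF \<alpha> h2])+
  fix z :: complex assume "norm z < cs_radius \<alpha> (h2 \<alpha>)"
  from norm_kphi_less[OF \<alpha> h2 this]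
  have w: "\<alpha> * norm (kphi \<alpha> z) < arctan \<alpha>" using \<alpha> by (simp add: h2_eq field_simps)
  define w where "w = kphi \<alpha> z"
  define R where "R = 2 * \<alpha> * norm w"
  have R: "R < 2 * arctan \<alpha>" "0 \<le> R" using w \<alpha> by (simp_all add: R_def w_def)
  have V: "2 * arctan \<alpha> < pi / 2" using arctan_less_pi4[OF \<alpha>(2)] by simp
  have "(2 * \<alpha> * Im w)\<^sup>2 + (2 * \<alpha> * Re w)\<^sup>2 = R\<^sup>2"
    by (simp add: R_def power_mult_distrib cmod_power2 algebra_simps)
  then have "sqrt ((2 * \<alpha> * Im w)\<^sup>2 + (2 * \<alpha> * Re w)\<^sup>2) = R" using R by simp
  then have key: "cosh (2 * \<alpha> * Re w) * cos R \<le> cos (2 * \<alpha> * Im w)"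
    using cosh_mult_cos_sqrt_le[of "2 * \<alpha> * Im w" "2 * \<alpha> * Re w"] R V by simp
  have "(1 - \<alpha>\<^sup>2) / (1 + \<alpha>\<^sup>2) < cos R"
    unfolding sin_cos_double_arctan(2)[symmetric] using R V by (intro cos_monotone_0_pi) auto
  then have "1 - \<alpha>\<^sup>2 < (1 + \<alpha>\<^sup>2) * cos R" by (simp add: field_simps add_pos_nonneg)
  then have "(1 - \<alpha>\<^sup>2) * cosh (2 * \<alpha> * Re w) < (1 + \<alpha>\<^sup>2) * cos R * cosh (2 * \<alpha> * Re w)"
    by (intro mult_strict_right_mono) auto
  also have "\<dots> \<le> (1 + \<alpha>\<^sup>2) * cos (2 * \<alpha> * Im w)"
    using key mult_left_mono[OF key, of "1 + \<alpha>\<^sup>2"] by (simp add: mult_ac)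
  finally have "(1 - \<alpha>\<^sup>2) * cosh (2 * \<alpha> * Re w) < (1 + \<alpha>\<^sup>2) * cos (2 * \<alpha> * Im w)" .
  moreover have "2 * \<alpha> * \<bar>Im w\<bar> \<le> R"
    unfolding R_def using \<alpha> abs_Im_le_cmod[of w] by simp
  ultimately show "2 * \<alpha> * \<bar>Im (kphi \<alpha> z)\<bar> < pi \<and>
      (1 - \<alpha>\<^sup>2) * cosh (2 * \<alpha> * Re (kphi \<alpha> z)) < (1 + \<alpha>\<^sup>2) * cos (2 * \<alpha> * Im (kphi \<alpha> z))"
    using R V by (simp add: w_def[symmetric])
qed

section \<open>Elementary bounds\<close>

text \<open>The coefficients are those that yield 2/5 in \<open>sinh_double_ratio_bound\<close> at x
  = 2 u. Four differentiations, through functions vanishing at 0, lead to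
  \<open>sinh_le_mult_cosh\<close>.\<close>

lemma sinh_rational_bound:
  fixes x :: real
  assumes x: "0 \<le> x"
  shows "(30 - 2 * x\<^sup>2) * sinh x \<le> x * (30 + 3 * x\<^sup>2)"
proof -
  define g4 where "g4 t = - 6 * sinh t + 16 * t * cosh t + 2 * t\<^sup>2 * sinh t" for t :: real
  define g3 where "g3 t = 18 - 18 * cosh t + 12 * t * sinh t + 2 * t\<^sup>2 * cosh t" for t :: real
  define g2 where "g2 t = 18 * t - 26 * sinh t + 8 * t * cosh t + 2 * t\<^sup>2 * sinh t" for t :: real
  define g1 where "g1 t = 30 + 9 * t\<^sup>2 + 4 * t * sinh t - (30 - 2 * t\<^sup>2) * cosh t" for t :: real
  define g0 where "g0 t = t * (30 + 3 * t\<^sup>2) - (30 - 2 * t\<^sup>2) * sinh t" for t :: real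
  have d3: "(g3 has_real_derivative g4 t) (at t)" for t
    unfolding g3_def g4_def by (auto intro!: derivative_eq_intros simp: algebra_simps)
  have d2: "(g2 has_real_derivative g3 t) (at t)" for t
    unfolding g2_def g3_def by (auto intro!: derivative_eq_intros simp: algebra_simps)
  have d1: "(g1 has_real_derivative g2 t) (at t)" for t
    unfolding g1_def g2_def by (auto intro!: derivative_eq_intros simp: algebra_simps)
  have d0: "(g0 has_real_derivative g1 t) (at t)" for t
    unfolding g0_def g1_def by (auto intro!: derivative_eq_intros simp: algebra_simps power2_eq_square)
  have "0 \<le> g4 t" if "0 \<le> t" for t
  proof -
    have "0 \<le> t * cosh t" "0 \<le> t\<^sup>2 * sinh t" using that by simp_all
    moreover have "g4 t = 16 * (t * cosh t) - 6 * sinh t + 2 * (t\<^sup>2 * sinh t)"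
      by (simp add: g4_def)
    ultimately show ?thesis using sinh_le_mult_cosh[OF that] by linarith
  qed
  then have "0 \<le> g3 t" if "0 \<le> t" for t
    using that by (intro nonneg_if_deriv_nonneg[of t g3 g4] d3) (auto simp: g3_def)
  then have "0 \<le> g2 t" if "0 \<le> t" for t
    using that by (intro nonneg_if_deriv_nonneg[of t g2 g3] d2) (auto simp: g2_def)
  then have "0 \<le> g1 t" if "0 \<le> t" for t
    using that by (intro nonneg_if_deriv_nonneg[of t g1 g2] d1) (auto simp: g1_def)
  then have "0 \<le> g0 x"
    using x by (intro nonneg_if_deriv_nonneg[of x g0 g1] d0) (auto simp: g0_def)
  then show ?thesis by (simp add: g0_def)
qed

lemma sin_le_taylor9:
  fixes y :: real
  assumes "0 \<le> y"
  shows "sin y \<le> y - y ^ 3 / 6 + y ^ 5 / 120 - y ^ 7 / 5040 + y ^ 9 / 362880"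
proof -
  have A: "\<bar>sin y - (\<Sum>m<9. sin_coeff m * y ^ m)\<bar> \<le> inverse (fact 9) * \<bar>y\<bar> ^ 9"
    by (rule Maclaurin_sin_bound)
  have S: "(\<Sum>m<9. sin_coeff m * y ^ m) = y - y ^ 3 / 6 + y ^ 5 / 120 - y ^ 7 / 5040"
  proof -
    have "{..<9::nat} = {0, 1, 2, 3, 4, 5, 6, 7, 8}" by auto
    then show ?thesis by (simp add: sin_coeff_def fact_numeral)
  qed
  have I: "inverse (fact 9) * \<bar>y\<bar> ^ 9 = y ^ 9 / 362880"
  proof -
    have "(fact 9 :: real) = 362880" "\<bar>y\<bar> = y" using assms by (simp_all add: fact_numeral)
    then show ?thesis by (simp only: divide_inverse mult.commute)
  qed
  show ?thesis using A unfolding S I by (simp only: abs_le_iff) linarith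
qed

text \<open>The formula of \<open>sinh_rational_bound\<close> at imaginary arguments, on a bounded
  range: 139/50 is twice 139/100, an upper bound for 2 arctan (4/5).\<close>

lemma sin_rational_bound:
  fixes y :: real
  assumes y: "0 \<le> y" "y \<le> 139 / 50"
  shows "(30 + 2 * y\<^sup>2) * sin y \<le> y * (30 - 3 * y\<^sup>2)"
proof -
  define t where "t = y\<^sup>2"
  have "y\<^sup>2 \<le> (139 / 50)\<^sup>2" using y by (intro power_mono) auto
  then have t: "0 \<le> t" "t \<le> 19321 / 2500" by (simp_all add: t_def power2_eq_square)
  have "(30 + 2 * y\<^sup>2) * sin y \<le>
      (30 + 2 * y\<^sup>2) * (y - y ^ 3 / 6 + y ^ 5 / 120 - y ^ 7 / 5040 + y ^ 9 / 362880)"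
    using sin_le_taylor9[OF y(1)] by (intro mult_left_mono) auto
  also have "\<dots> = y * (30 - 3 * y\<^sup>2)
      - y ^ 5 * (1 / 12 - 3 / 280 * t + t\<^sup>2 * (19 / 60480 - t / 181440))"
  proof -
    have ps: "y ^ 3 = y * t" "y ^ 5 = y * t\<^sup>2" "y ^ 7 = y * t ^ 3" "y ^ 9 = y * t ^ 4"
      by (simp_all add: t_def eval_nat_numeral)
    show ?thesis
      unfolding ps t_def[symmetric] by (simp add: field_simps power2_eq_square power3_eq_cube power4_eq_xxxx)
  qed
  also have "\<dots> \<le> y * (30 - 3 * y\<^sup>2)"
  proof -
    \<comment> \<open>This is t \<le> 70/9, and (139/50)^2 = 7.7284 is just below.\<close>
    have "0 \<le> 1 / 12 - 3 / 280 * t" using t by simp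
    moreover have "0 \<le> t\<^sup>2 * (19 / 60480 - t / 181440)" using t by (intro mult_nonneg_nonneg) auto
    ultimately show ?thesis using y by simp
  qed
  finally show ?thesis .
qed

text \<open>The left side is the Pade approximant of arctan at 0 with linear numerator and quadratic
  denominator.\<close>

lemma arctan_ge_rational:
  fixes x :: real
  assumes "0 \<le> x"
  shows "3 * x / (3 + x\<^sup>2) \<le> arctan x"
proof -
  define f where "f t = arctan t - 3 * t / (3 + t\<^sup>2)" for t :: real
  define f' where "f' t = inverse (1 + t\<^sup>2)
      - (3 * (3 + t\<^sup>2) - 3 * t * (2 * t)) / ((3 + t\<^sup>2) * (3 + t\<^sup>2))" for t :: real
  have "0 \<le> f x"
    using assms
  proof (rule nonneg_if_deriv_nonneg[where f' = f'])
    fix t :: real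
    have p: "1 + t\<^sup>2 > 0" "3 + t\<^sup>2 > 0" by (simp_all add: add_pos_nonneg)
    show "(f has_real_derivative f' t) (at t)"
      unfolding f_def f'_def using p(2) by (auto intro!: derivative_eq_intros)
    have "(3 * (3 + t\<^sup>2) - 3 * t * (2 * t)) * (1 + t\<^sup>2) + 4 * (t\<^sup>2)\<^sup>2 = (3 + t\<^sup>2) * (3 + t\<^sup>2)"
      by algebra
    moreover have "0 \<le> 4 * (t\<^sup>2)\<^sup>2" by simp
    ultimately have "(3 * (3 + t\<^sup>2) - 3 * t * (2 * t)) * (1 + t\<^sup>2) \<le> 1 * ((3 + t\<^sup>2) * (3 + t\<^sup>2))"
      by linarith
    then have "(3 * (3 + t\<^sup>2) - 3 * t * (2 * t)) / ((3 + t\<^sup>2) * (3 + t\<^sup>2)) \<le> 1 / (1 + t\<^sup>2)"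
      using p by (simp only: divide_le_eq pos_le_divide_eq mult_pos_pos if_True times_divide_eq_left pos_divide_le_eq)
    then show "0 \<le> f' t"
      unfolding f'_def by (simp add: inverse_eq_divide)
  qed (simp add: f_def)
  then show ?thesis by (simp add: f_def)
qed

text \<open>x / artanh x = 1 - x^2 / 3 - 4/45 x^4 - ...; the larger coefficient 1/5 pays for the
  higher terms up to x = 4/5. With the polynomial in the denominator, 1 / (artanh x)^2 gets a lower
  bound that is a polynomial over x^2.\<close>

lemma artanh_le_rational:
  fixes x :: real
  assumes "0 \<le> x" "x \<le> 4 / 5"
  shows "artanh x \<le> x / (1 - x\<^sup>2 / 3 - x ^ 4 / 5)" "0 < 1 - x\<^sup>2 / 3 - x ^ 4 / 5"
proof -
  define q where "q t = 1 - t\<^sup>2 / 3 - t ^ 4 / 5" for t :: real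
  have sq: "0 \<le> t\<^sup>2" "t\<^sup>2 \<le> 16 / 25" if "0 \<le> t" "t \<le> 4 / 5" for t :: real
    using that power_mono[of t "4 / 5" 2] by (simp_all add: power2_eq_square)
  have p4: "t ^ 4 = (t\<^sup>2)\<^sup>2" for t :: real by simp
  have q: "0 < q t" if "0 \<le> t" "t \<le> 4 / 5" for t
  proof -
    have "(t\<^sup>2)\<^sup>2 \<le> (16 / 25)\<^sup>2" using sq[OF that] by (intro power_mono) auto
    then show ?thesis using sq[OF that] by (simp add: q_def p4 power2_eq_square)
  qed
  define f where "f t = t / q t - artanh t" for t :: real
  define f' where "f' t = (q t + t * (2 * t / 3 + 4 * t ^ 3 / 5)) / (q t)\<^sup>2 - 1 / (1 - t\<^sup>2)" for t :: real
  have "0 \<le> f x"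
    using assms(1)
  proof (rule nonneg_if_deriv_nonneg[where f' = f'])
    fix t :: real assume t: "0 \<le> t" "t \<le> x"
    with assms have t': "0 \<le> t" "t \<le> 4 / 5" by auto
    note s = sq[OF t'] and q = q[OF t']
    have dq: "(q has_real_derivative - (2 * t / 3 + 4 * t ^ 3 / 5)) (at t)"
      unfolding q_def by (auto intro!: derivative_eq_intros)
    show "(f has_real_derivative f' t) (at t)"
      unfolding f_def f'_def using q t'
      by (auto intro!: derivative_eq_intros dq simp: power2_eq_square algebra_simps)
    define u where "u = t\<^sup>2"
    have u: "0 \<le> u" "u \<le> 16 / 25" using s by (simp_all add: u_def)
    have n: "q t + t * (2 * t / 3 + 4 * t ^ 3 / 5) = 1 + u / 3 + 3 * u\<^sup>2 / 5"
      by (simp add: q_def u_def field_simps eval_nat_numeral)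
    have qu: "q t = 1 - u / 3 - u\<^sup>2 / 5" by (simp add: q_def u_def)
    have "(1 + u / 3 + 3 * u\<^sup>2 / 5) * (1 - u) - (q t)\<^sup>2 = u\<^sup>2 * (5 / 9 - 11 / 15 * u - u\<^sup>2 / 25)"
      unfolding qu by (simp add: field_simps eval_nat_numeral)
    moreover have "0 \<le> u\<^sup>2 * (5 / 9 - 11 / 15 * u - u\<^sup>2 / 25)"
    proof -
      have "u\<^sup>2 \<le> (16 / 25)\<^sup>2" using u by (intro power_mono) auto
      then show ?thesis using u by (intro mult_nonneg_nonneg) (auto simp: power2_eq_square)
    qed
    ultimately have le: "(q t)\<^sup>2 \<le> (1 + u / 3 + 3 * u\<^sup>2 / 5) * (1 - u)" by simp
    have "1 / (1 - u) \<le> (1 + u / 3 + 3 * u\<^sup>2 / 5) / (q t)\<^sup>2"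
      using le q u by (simp add: divide_simps mult_ac)
    then show "0 \<le> f' t" unfolding f'_def n u_def[symmetric] by simp
  qed (simp add: f_def)
  then show "artanh x \<le> x / (1 - x\<^sup>2 / 3 - x ^ 4 / 5)" by (simp add: f_def q_def)
  show "0 < 1 - x\<^sup>2 / 3 - x ^ 4 / 5" using q[OF assms] by (simp add: q_def)
qed

lemma arctan_le_taylor5:
  fixes x :: real
  assumes "0 \<le> x"
  shows "arctan x \<le> x - x ^ 3 / 3 + x ^ 5 / 5"
proof -
  have "0 \<le> x - x ^ 3 / 3 + x ^ 5 / 5 - arctan x"
    using assms
  proof (rule nonneg_if_deriv_nonneg[where f' = "\<lambda>t. 1 - t\<^sup>2 + t ^ 4 - inverse (1 + t\<^sup>2)"])
    fix t :: real
    show "((\<lambda>t. t - t ^ 3 / 3 + t ^ 5 / 5 - arctan t) has_real_derivative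
        1 - t\<^sup>2 + t ^ 4 - inverse (1 + t\<^sup>2)) (at t)"
      by (auto intro!: derivative_eq_intros)
    have p: "0 < 1 + t\<^sup>2" by (simp add: add_pos_nonneg)
    have "(1 - t\<^sup>2 + t ^ 4) * (1 + t\<^sup>2) = 1 + t ^ 6" by algebra
    then have "1 \<le> (1 - t\<^sup>2 + t ^ 4) * (1 + t\<^sup>2)" by simp
    then have "1 / (1 + t\<^sup>2) \<le> 1 - t\<^sup>2 + t ^ 4" using p by (simp only: pos_divide_le_eq)
    then show "0 \<le> 1 - t\<^sup>2 + t ^ 4 - inverse (1 + t\<^sup>2)" by (simp add: inverse_eq_divide)
  qed simp
  then show ?thesis by simp
qed

lemma artanh_ge_taylor5:
  fixes x :: real
  assumes "0 \<le> x" "x < 1"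
  shows "x + x ^ 3 / 3 + x ^ 5 / 5 \<le> artanh x"
proof -
  have "0 \<le> artanh x - (x + x ^ 3 / 3 + x ^ 5 / 5)"
    using assms(1)
  proof (rule nonneg_if_deriv_nonneg[where f' = "\<lambda>t. 1 / (1 - t\<^sup>2) - (1 + t\<^sup>2 + t ^ 4)"])
    fix t assume t: "0 \<le> t" "t \<le> x"
    then have "\<bar>t\<bar> < 1" using assms by auto
    then show "((\<lambda>t. artanh t - (t + t ^ 3 / 3 + t ^ 5 / 5)) has_real_derivative
        1 / (1 - t\<^sup>2) - (1 + t\<^sup>2 + t ^ 4)) (at t)"
      by (auto intro!: derivative_eq_intros)
    have p: "0 < 1 - t\<^sup>2" using t assms by (simp add: power_less_one_iff)
    have "(1 + t\<^sup>2 + t ^ 4) * (1 - t\<^sup>2) = 1 - t ^ 6" by algebra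
    then have "(1 + t\<^sup>2 + t ^ 4) * (1 - t\<^sup>2) \<le> 1" by simp
    then show "0 \<le> 1 / (1 - t\<^sup>2) - (1 + t\<^sup>2 + t ^ 4)"
      using p by (simp only: pos_le_divide_eq diff_ge_0_iff_ge)
  qed simp
  then show ?thesis by simp
qed

lemma artanh_ge:
  fixes x :: real
  assumes "0 \<le> x" "x < 1"
  shows "x \<le> artanh x"
proof -
  have "0 \<le> x ^ 3" "0 \<le> x ^ 5" using assms by simp_all
  then show ?thesis using artanh_ge_taylor5[OF assms] by linarith
qed

text \<open>Four times the condition of \<open>cosh_cos_ellipse\<close> on U = 2 artanh x and V = 2
  arctan x.\<close>

lemma inverse_square_arctan_artanh:
  fixes x :: real
  assumes x: "0 < x" "x \<le> 4 / 5"
  shows "1 / (arctan x)\<^sup>2 - 1 / (artanh x)\<^sup>2 \<le> 8 / 5"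
proof -
  define u where "u = x\<^sup>2"
  have "x\<^sup>2 \<le> (4 / 5)\<^sup>2" using x by (intro power_mono) auto
  then have u: "0 < u" "u \<le> 16 / 25" using x by (simp_all add: u_def power2_eq_square)
  define q where "q = 1 - u / 3 - u\<^sup>2 / 5"
  have a: "0 < artanh x" "artanh x \<le> x / q" "0 < q"
    using artanh_le_rational[of x] artanh_ge[of x] x by (simp_all add: q_def u_def)
  have b: "0 < 3 * x / (3 + u)" "3 * x / (3 + u) \<le> arctan x"
    using arctan_ge_rational[of x] x by (simp_all add: u_def add_pos_nonneg)
  have "1 / (arctan x)\<^sup>2 \<le> 1 / (3 * x / (3 + u))\<^sup>2"
    using b x by (intro divide_left_mono power_mono mult_pos_pos zero_less_power) auto
  also have "\<dots> = (3 + u)\<^sup>2 / (9 * u)" by (simp add: power_divide u_def power_mult_distrib)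
  finally have 1: "1 / (arctan x)\<^sup>2 \<le> (3 + u)\<^sup>2 / (9 * u)" .
  have "q\<^sup>2 / u = 1 / (x / q)\<^sup>2" by (simp add: power_divide u_def)
  also have "\<dots> \<le> 1 / (artanh x)\<^sup>2"
    using a x by (intro divide_left_mono power_mono mult_pos_pos zero_less_power) auto
  finally have 2: "q\<^sup>2 / u \<le> 1 / (artanh x)\<^sup>2" .
  have "(3 + u)\<^sup>2 / (9 * u) - q\<^sup>2 / u = 4 / 3 + 2 / 5 * u - 2 / 15 * u\<^sup>2 - u ^ 3 / 25"
    using u unfolding q_def by (simp add: field_simps eval_nat_numeral)
  also have "\<dots> \<le> 4 / 3 + 2 / 5 * u"
  proof -
    have "0 \<le> u\<^sup>2" "0 \<le> u ^ 3" using u by simp_all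
    then show ?thesis by linarith
  qed
  \<comment> \<open>This amounts to u \<le> 2/3, so the range x \<le> 4/5 nearly exhausts these
    bounds.\<close>
  also have "\<dots> \<le> 8 / 5" using u by simp
  finally show ?thesis using 1 2 by linarith
qed

section \<open>The ellipse in the image\<close>

text \<open>A function that first decreases and then increases is bounded by its end values. The
  increasing \<open>g\<close> only has to share the sign of f', so a difference of logarithms may
  stand in for f'. Derivatives are taken on the open interval because of the square roots in the
  application.\<close>

lemma single_crossing_le:
  fixes f f' g :: "real \<Rightarrow> real"
  assumes cont: "continuous_on {a..b} f"
    and der: "\<And>t. a < t \<Longrightarrow> t < b \<Longrightarrow> (f has_real_derivative f' t) (at t)"
    and sign: "\<And>t. a < t \<Longrightarrow> t < b \<Longrightarrow> 0 \<le> f' t \<longleftrightarrow> 0 \<le> g t"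
    and mono: "\<And>s t. a < s \<Longrightarrow> s \<le> t \<Longrightarrow> t < b \<Longrightarrow> g s \<le> g t"
    and ends: "f a \<le> L" "f b \<le> L"
    and s: "a \<le> s" "s \<le> b"
  shows "f s \<le> L"
proof (cases "s = a \<or> s = b")
  case False
  then have s': "a < s" "s < b" using s by auto
  show ?thesis
  proof (cases "0 \<le> g s")
    case True
    have "f s \<le> f b"
    proof (rule DERIV_nonneg_imp_increasing_open[of s b f])
      show "continuous_on {s..b} f" by (rule continuous_on_subset[OF cont]) (use s in auto)
      fix t assume "s < t" "t < b"
      then show "\<exists>y. (f has_real_derivative y) (at t) \<and> 0 \<le> y"
        using der[of t] sign[of t] mono[of s t] True s' by fastforce
    qed (use s in auto)
    then show ?thesis using ends by simp
  next
    case False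
    have "f s \<le> f a"
    proof (rule DERIV_nonpos_imp_decreasing_open[of a s f])
      show "continuous_on {a..s} f" by (rule continuous_on_subset[OF cont]) (use s in auto)
      fix t assume "a < t" "t < s"
      then show "\<exists>y. (f has_real_derivative y) (at t) \<and> y \<le> 0"
        using der[of t] sign[of t] mono[of t s] False s' by fastforce
    qed (use s in auto)
    then show ?thesis using ends by simp
  qed
qed (use ends in auto)

lemma sinh_double_ratio_bound:
  fixes u :: real
  assumes "0 < u"
  shows "1 - 2 * u / sinh (2 * u) \<le> 2 / 3 * u\<^sup>2 / (1 + 2 / 5 * u\<^sup>2)"
proof -
  define S where "S = sinh (2 * u)"
  have S: "S > 0" using assms by (simp add: S_def)
  have p: "1 + 2 / 5 * u\<^sup>2 > 0" by (simp add: add_pos_nonneg)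
  have "(30 - 2 * (2 * u)\<^sup>2) * S \<le> 2 * u * (30 + 3 * (2 * u)\<^sup>2)"
    unfolding S_def using assms by (intro sinh_rational_bound) simp
  then have "(1 + 2 / 5 * u\<^sup>2 - 2 / 3 * u\<^sup>2) * S \<le> 2 * u * (1 + 2 / 5 * u\<^sup>2)"
    by (simp add: power_mult_distrib algebra_simps)
  then have "(1 + 2 / 5 * u\<^sup>2 - 2 / 3 * u\<^sup>2) / (1 + 2 / 5 * u\<^sup>2) \<le> 2 * u / S"
    using S p by (simp only: pos_divide_le_eq pos_le_divide_eq times_divide_eq_left)
  also have "(1 + 2 / 5 * u\<^sup>2 - 2 / 3 * u\<^sup>2) / (1 + 2 / 5 * u\<^sup>2)
      = 1 - 2 / 3 * u\<^sup>2 / (1 + 2 / 5 * u\<^sup>2)"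
    using p by (subst diff_divide_distrib, subst divide_self) auto
  finally show ?thesis unfolding S_def by linarith
qed

lemma sin_double_ratio_bound:
  fixes v :: real
  assumes "0 < v" "v \<le> 139 / 100"
  shows "2 / 3 * v\<^sup>2 / (1 - 2 / 5 * v\<^sup>2) \<le> 2 * v / sin (2 * v) - 1" "0 < 1 - 2 / 5 * v\<^sup>2"
proof -
  define S where "S = sin (2 * v)"
  have "2 * v < pi" using assms pi_gt3 by linarith
  then have S: "S > 0" unfolding S_def using assms by (intro sin_gt_zero) auto
  have "v\<^sup>2 \<le> (139 / 100)\<^sup>2" using assms by (intro power_mono) auto
  then show p: "1 - 2 / 5 * v\<^sup>2 > 0" by (simp add: power2_eq_square)
  have "(30 + 2 * (2 * v)\<^sup>2) * S \<le> 2 * v * (30 - 3 * (2 * v)\<^sup>2)"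
    unfolding S_def using assms by (intro sin_rational_bound) simp_all
  then have "(1 - 2 / 5 * v\<^sup>2 + 2 / 3 * v\<^sup>2) * S \<le> 2 * v * (1 - 2 / 5 * v\<^sup>2)"
    by (simp add: power_mult_distrib algebra_simps)
  then have "(1 - 2 / 5 * v\<^sup>2 + 2 / 3 * v\<^sup>2) / (1 - 2 / 5 * v\<^sup>2) \<le> 2 * v / S"
    using S p by (simp only: pos_divide_le_eq pos_le_divide_eq times_divide_eq_left)
  also have "(1 - 2 / 5 * v\<^sup>2 + 2 / 3 * v\<^sup>2) / (1 - 2 / 5 * v\<^sup>2)
      = 1 + 2 / 3 * v\<^sup>2 / (1 - 2 / 5 * v\<^sup>2)"
    using p by (subst add_divide_distrib, subst divide_self) auto
  finally show "2 / 3 * v\<^sup>2 / (1 - 2 / 5 * v\<^sup>2) \<le> 2 * v / sin (2 * v) - 1"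
    unfolding S_def by linarith
qed

text \<open>In the variable \<open>s\<close> the boundary arc of the ellipse becomes a segment, and
  \<open>ln cosh (U \<surd>s) - ln cos (V \<surd>(1 - s))\<close> first decreases and then increases: its derivative has the
  sign of \<open>ln (tanh u / u) - ln (tan v / v)\<close> plus a constant, \<open>u = U \<surd>s\<close>, \<open>v = V \<surd>(1 - s)\<close>, which
  increases in \<open>s\<close>. With the constant \<open>2/5\<close> in both rational bounds, that monotonicity reduces to a
  condition on \<open>U\<close> and \<open>V\<close> alone.\<close>

lemma cosh_cos_ellipse:
  fixes U V s :: real
  assumes U: "0 < U" and V: "0 < V" "V \<le> 139 / 100"
    and UV: "1 / V\<^sup>2 - 1 / U\<^sup>2 \<le> 2 / 5"
    and ends: "cosh U * cos V = 1"
    and s: "0 \<le> s" "s \<le> 1"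
  shows "cosh (U * sqrt s) \<le> cosh U * cos (V * sqrt (1 - s))"
proof -
  define u where "u t = U * sqrt t" for t
  define v where "v t = V * sqrt (1 - t)" for t
  have u: "u t > 0" "(u t)\<^sup>2 = U\<^sup>2 * t" if "0 < t" for t
    using that U by (simp_all add: u_def power_mult_distrib)
  have vle: "0 \<le> v t" "v t \<le> V" if "0 \<le> t" "t \<le> 1" for t
    using that V by (auto simp: v_def intro!: mult_left_le)
  have v: "v t > 0" "(v t)\<^sup>2 = V\<^sup>2 * (1 - t)" if "t < 1" for t
    using that V by (simp_all add: v_def power_mult_distrib)
  have Vpi: "V < pi / 2" using V pi_gt3 by linarith
  have cosv: "cos (v t) > 0" if "0 \<le> t" "t \<le> 1" for t
    using vle[OF that] Vpi by (intro cos_gt_zero_pi) auto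
  have sinv: "sin (v t) > 0" if "0 \<le> t" "t < 1" for t
    using vle[of t] that v(1)[of t] Vpi by (intro sin_gt_zero) auto
  have du: "(u has_real_derivative u t / (2 * t)) (at t)" if "0 < t" for t
  proof -
    have "(u has_real_derivative U * (inverse (sqrt t) / 2)) (at t)"
      unfolding u_def using that by (auto intro!: derivative_eq_intros)
    moreover have "U * (inverse (sqrt t) / 2) = u t / (2 * t)"
      using that by (simp add: u_def field_simps)
    ultimately show ?thesis by (simp only:)
  qed
  have dv: "(v has_real_derivative - (v t / (2 * (1 - t)))) (at t)" if "t < 1" for t
  proof -
    have "(v has_real_derivative V * (- inverse (sqrt (1 - t)) / 2)) (at t)"
      unfolding v_def using that by (auto intro!: derivative_eq_intros)
    moreover have "V * (- inverse (sqrt (1 - t)) / 2) = - (v t / (2 * (1 - t)))"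
    proof -
      have "v t / (2 * (1 - t)) = V * (sqrt (1 - t) / (1 - t)) / 2" by (simp add: v_def)
      also have "sqrt (1 - t) / (1 - t) = inverse (sqrt (1 - t))"
        using that by (intro sqrt_divide_self_eq) simp
      finally show ?thesis by simp
    qed
    ultimately show ?thesis by (simp only:)
  qed
  define f where "f t = ln (cosh (u t)) - ln (cos (v t))" for t
  define f' where "f' t = (u t * (sinh (u t) / cosh (u t)) / t
      - v t * (sin (v t) / cos (v t)) / (1 - t)) / 2" for t
  define g where "g t = (ln (sinh (u t)) - ln (cosh (u t)) - ln (u t))
      - (ln (sin (v t)) - ln (cos (v t)) - ln (v t)) + (ln (U\<^sup>2) - ln (V\<^sup>2))" for t
  have "f s \<le> ln (cosh U)"
  proof (rule single_crossing_le[where a = 0 and b = 1 and f = f and f' = f' and g = g])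
    have "cos (v t) \<noteq> 0" if "t \<in> {0..1}" for t using cosv[of t] that by auto
    then show "continuous_on {0..1} f"
      unfolding f_def u_def v_def by (intro continuous_intros) auto
    fix t :: real assume t: "0 < t" "t < 1"
    then have c: "cos (v t) > 0" and sn: "sin (v t) > 0" by (simp_all add: cosv sinv)
    note ut = u[OF t(1)] and vt = v[OF t(2)]
    have d1: "((\<lambda>w. ln (cosh w)) has_real_derivative sinh (u t) / cosh (u t)) (at (u t))"
      by (auto intro!: derivative_eq_intros)
    have d2: "((\<lambda>w. ln (cos w)) has_real_derivative - sin (v t) / cos (v t)) (at (v t))"
      using c by (auto intro!: derivative_eq_intros)
    have "(f has_real_derivative sinh (u t) / cosh (u t) * (u t / (2 * t))
        - - sin (v t) / cos (v t) * - (v t / (2 * (1 - t)))) (at t)"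
      unfolding f_def
      by (intro DERIV_diff DERIV_chain2[OF d1 du[OF t(1)]] DERIV_chain2[OF d2 dv[OF t(2)]])
    also have "sinh (u t) / cosh (u t) * (u t / (2 * t))
        - - sin (v t) / cos (v t) * - (v t / (2 * (1 - t))) = f' t"
      by (simp add: f'_def diff_divide_distrib mult_ac)
    finally show "(f has_real_derivative f' t) (at t)" .
    \<comment> \<open>f' is (p - q) / 2 with p and q positive; comparing logarithms keeps the sign
      and gives a sum of terms in \<open>u\<close> alone and in \<open>v\<close> alone.\<close>
    define p where "p = U\<^sup>2 * (sinh (u t) / (cosh (u t) * u t))"
    define q where "q = V\<^sup>2 * (sin (v t) / (cos (v t) * v t))"
    have pq: "p > 0" "q > 0" using U V ut vt c sn by (simp_all add: p_def q_def)
    have "u t * (sinh (u t) / cosh (u t)) / t = p"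
      using ut t U by (simp add: p_def divide_simps power2_eq_square[symmetric])
    moreover have "v t * (sin (v t) / cos (v t)) / (1 - t) = q"
      using vt t V c by (simp add: q_def divide_simps power2_eq_square[symmetric])
    ultimately have f': "f' t = (p - q) / 2" by (simp add: f'_def)
    have g: "g t = ln p - ln q"
      using ut(1) vt(1) c sn U V by (simp add: g_def p_def q_def ln_mult ln_div)
    show "0 \<le> f' t \<longleftrightarrow> 0 \<le> g t" unfolding f' g using pq by simp
  next
    fix s t :: real assume st: "0 < s" "s \<le> t" "t < 1"
    show "g s \<le> g t"
    proof (rule DERIV_nonneg_imp_nondecreasing[OF st(2)])
      fix x assume x: "s \<le> x" "x \<le> t"
      then have x': "0 < x" "x < 1" using st by auto
      note ux = u[OF x'(1)] and vx = v[OF x'(2)]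
      have c: "cos (v x) > 0" and sn: "sin (v x) > 0" using x' by (simp_all add: cosv sinv)
      have sh: "sinh (u x) > 0" using ux by simp
      define P where "P = cosh (u x) / sinh (u x) - sinh (u x) / cosh (u x) - 1 / u x"
      define Q where "Q = cos (v x) / sin (v x) - - sin (v x) / cos (v x) - 1 / v x"
      have d1: "((\<lambda>w. ln (sinh w) - ln (cosh w) - ln w) has_real_derivative P) (at (u x))"
        unfolding P_def using ux sh by (auto intro!: derivative_eq_intros)
      have d2: "((\<lambda>w. ln (sin w) - ln (cos w) - ln w) has_real_derivative Q) (at (v x))"
        unfolding Q_def using vx c sn by (auto intro!: derivative_eq_intros)
      have dg: "(g has_real_derivative P * (u x / (2 * x)) - Q * - (v x / (2 * (1 - x))) + 0) (at x)"
        unfolding g_def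
        by (intro DERIV_add DERIV_diff DERIV_const DERIV_chain2[OF d1 du[OF x'(1)]]
              DERIV_chain2[OF d2 dv[OF x'(2)]])
      have "P * u x = 2 * u x / sinh (2 * u x) - 1"
      proof -
        have "cosh (u x) / sinh (u x) - sinh (u x) / cosh (u x) = 2 / sinh (2 * u x)"
          using sh cosh_square_eq[of "u x"]
          by (simp add: sinh_double divide_simps power2_eq_square[symmetric])
        then show ?thesis using ux unfolding P_def by (simp add: field_simps)
      qed
      with sinh_double_ratio_bound[OF ux(1)]
      have Pge: "- (2 / 3 * (u x)\<^sup>2 / (1 + 2 / 5 * (u x)\<^sup>2)) \<le> P * u x" by simp
      have "Q * v x = 2 * v x / sin (2 * v x) - 1"
      proof -
        have "cos (v x) / sin (v x) - - sin (v x) / cos (v x) = 2 / sin (2 * v x)"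
          using sn c sin_cos_squared_add[of "v x"]
          by (simp add: sin_double divide_simps power2_eq_square[symmetric])
        then show ?thesis using vx unfolding Q_def by (simp add: field_simps)
      qed
      moreover have "v x \<le> 139 / 100" using vle[of x] x' V by simp
      note vb = sin_double_ratio_bound[OF vx(1) this]
      ultimately have Qge: "2 / 3 * (v x)\<^sup>2 / (1 - 2 / 5 * (v x)\<^sup>2) \<le> Q * v x" by simp
      have pu: "1 + 2 / 5 * (u x)\<^sup>2 > 0" by (simp add: add_pos_nonneg)
      \<comment> \<open>In the inequality derived from this one the terms in x cancel, because both
        denominators carry the same constant 2/5; what remains is \<open>UV\<close>.\<close>
      have "U\<^sup>2 - V\<^sup>2 \<le> 2 / 5 * (U\<^sup>2 * V\<^sup>2)"
        using UV U V by (simp add: field_simps)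
      then have "U\<^sup>2 * (1 - 2 / 5 * (v x)\<^sup>2) \<le> V\<^sup>2 * (1 + 2 / 5 * (u x)\<^sup>2)"
        unfolding ux(2) vx(2) by (simp add: algebra_simps)
      then have 1: "U\<^sup>2 / (1 + 2 / 5 * (u x)\<^sup>2) \<le> V\<^sup>2 / (1 - 2 / 5 * (v x)\<^sup>2)"
        using pu vb(2) by (simp only: pos_divide_le_eq pos_le_divide_eq times_divide_eq_left)
      have 2: "- (2 / 3 * (U\<^sup>2 / (1 + 2 / 5 * (u x)\<^sup>2))) \<le> P * u x / x"
        using divide_right_mono[OF Pge, of x] x' by (simp add: ux(2))
      have 3: "2 / 3 * (V\<^sup>2 / (1 - 2 / 5 * (v x)\<^sup>2)) \<le> Q * v x / (1 - x)"
        using divide_right_mono[OF Qge, of "1 - x"] x' by (simp add: vx(2))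
      have "0 \<le> (p + q) / 2" if "a \<le> b" "- (2 / 3 * a) \<le> p" "2 / 3 * b \<le> q" for a b p q :: real
        using that by simp
      from this[OF 1 2 3]
      have "0 \<le> P * (u x / (2 * x)) - Q * - (v x / (2 * (1 - x))) + 0"
        using x' by (simp add: add_divide_distrib mult_ac)
      with dg show "\<exists>y. (g has_real_derivative y) (at x) \<and> 0 \<le> y" by blast
    qed
  next
    have cV: "cos V > 0" using V Vpi by (intro cos_gt_zero_pi) auto
    have "ln (cosh U * cos V) = ln (cosh U) + ln (cos V)" using cV by (intro ln_mult_pos) auto
    then have "ln (cosh U) + ln (cos V) = 0" using ends by simp
    then show "f 0 \<le> ln (cosh U)" by (simp add: f_def u_def v_def)
    show "f 1 \<le> ln (cosh U)" by (simp add: f_def u_def v_def)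
  qed (use s in auto)
  then have "ln (cosh (u s)) \<le> ln (cosh U * cos (v s))"
    using cosv[OF s] by (simp add: f_def ln_mult)
  then show ?thesis using cosv[OF s] by (simp add: u_def v_def)
qed

section \<open>The ellipse condition as a polynomial inequality\<close>

text \<open>For z = r exp (i \<theta>), c = cos \<theta> and d = |(1 - z)(1 + \<alpha> z)|^2 this is
  d^2 (Q - 1), where Q = (Re w / h)^2 + (Im w / k)^2 at w = \<open>kphi \<alpha> z\<close>: positive
  exactly outside the ellipse.\<close>

definition ellipse_gap :: "real \<Rightarrow> real \<Rightarrow> real \<Rightarrow> real \<Rightarrow> real \<Rightarrow> real" where
  "ellipse_gap \<alpha> r h k c =
     (r * ((\<alpha> - 1) * r + c * (1 - \<alpha> * r\<^sup>2)))\<^sup>2 / h\<^sup>2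
     + (r * (1 + \<alpha> * r\<^sup>2))\<^sup>2 * (1 - c\<^sup>2) / k\<^sup>2
     - ((1 + r\<^sup>2 - 2 * r * c) * (1 + \<alpha>\<^sup>2 * r\<^sup>2 + 2 * \<alpha> * r * c))\<^sup>2"

lemma alpha0_equation_iff_gap:
  "alpha0_equation \<alpha> \<theta> \<longleftrightarrow> ellipse_gap \<alpha> (r0 \<alpha>) (h1 \<alpha>) (h2 \<alpha>) (cos \<theta>) = 0"
  by (simp add: alpha0_equation_def ellipse_gap_def N_def sin_squared_eq power_mult_distrib mult_ac)

lemma ellipse_gap_eliminate:
  assumes "h > 0" "r = h * ((1 - r) * (1 + \<alpha> * r))"
  shows "ellipse_gap \<alpha> r h k c =
    ((1 - r) * (1 + \<alpha> * r) * ((\<alpha> - 1) * r + c * (1 - \<alpha> * r\<^sup>2)))\<^sup>2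
     + (r * (1 + \<alpha> * r\<^sup>2))\<^sup>2 * (1 - c\<^sup>2) / k\<^sup>2
     - ((1 + r\<^sup>2 - 2 * r * c) * (1 + \<alpha>\<^sup>2 * r\<^sup>2 + 2 * \<alpha> * r * c))\<^sup>2"
proof -
  have "r / h = (1 - r) * (1 + \<alpha> * r)" using assms by (simp add: field_simps)
  then have "(r * X)\<^sup>2 / h\<^sup>2 = ((1 - r) * (1 + \<alpha> * r) * X)\<^sup>2" for X
    by (metis power_divide times_divide_eq_left)
  then show ?thesis by (simp only: ellipse_gap_def)
qed

text \<open>Contact at the vertex: the hypothesis says that \<open>kphi\<close> takes the value h at
  r.\<close>

lemma ellipse_gap_at_1:
  assumes "h > 0" "r = h * ((1 - r) * (1 + \<alpha> * r))"
  shows "ellipse_gap \<alpha> r h k 1 = 0"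
proof -
  have "(1 - r) * (1 + \<alpha> * r) * ((\<alpha> - 1) * r + 1 * (1 - \<alpha> * r\<^sup>2))
      = (1 + r\<^sup>2 - 2 * r * 1) * (1 + \<alpha>\<^sup>2 * r\<^sup>2 + 2 * \<alpha> * r * 1)" by algebra
  then show ?thesis unfolding ellipse_gap_eliminate[OF assms] by simp
qed

text \<open>The two quotients add up to at most 16/9 r^2 W, which is below W^2 because 16/9 r^2 < 1
  + r^2 \<le> W for r < 1. The bound 3/4 holds for \<open>h2\<close> on all of (0, 1).\<close>

lemma ellipse_gap_at_0:
  assumes \<alpha>: "0 < \<alpha>" "\<alpha> < 1" and r: "0 < r" "r < 1" and h: "1 \<le> h" and k: "3 / 4 \<le> k"
  shows "ellipse_gap \<alpha> r h k 0 < 0"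
proof -
  define M where "M = (1 + \<alpha> * r\<^sup>2)\<^sup>2"
  define W where "W = (1 + r\<^sup>2) * (1 + \<alpha>\<^sup>2 * r\<^sup>2)"
  have WM: "W = M + r\<^sup>2 * (1 - \<alpha>)\<^sup>2" unfolding W_def M_def by algebra
  have M: "0 \<le> M" by (simp add: M_def)
  have "1 \<le> 1 + \<alpha>\<^sup>2 * r\<^sup>2" by simp
  then have "(1 + r\<^sup>2) * 1 \<le> W" unfolding W_def by (intro mult_left_mono) auto
  then have W: "1 + r\<^sup>2 \<le> W" by simp
  have r2: "r\<^sup>2 < 1" "0 < r\<^sup>2" using r by (simp_all add: power_less_one_iff)
  have "(r * ((\<alpha> - 1) * r))\<^sup>2 / h\<^sup>2 \<le> (r * ((\<alpha> - 1) * r))\<^sup>2 / 1"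
    using h by (intro divide_left_mono) (auto simp: power_mono one_le_power)
  also have "\<dots> = r\<^sup>2 * (r\<^sup>2 * (1 - \<alpha>)\<^sup>2)" by algebra
  also have "\<dots> = r\<^sup>2 * (W - M)" unfolding WM by simp
  finally have 1: "(r * ((\<alpha> - 1) * r))\<^sup>2 / h\<^sup>2 \<le> r\<^sup>2 * (W - M)" .
  have "(3 / 4)\<^sup>2 \<le> k\<^sup>2" using k by (intro power_mono) auto
  then have "(r * (1 + \<alpha> * r\<^sup>2))\<^sup>2 / k\<^sup>2 \<le> (r * (1 + \<alpha> * r\<^sup>2))\<^sup>2 / (3 / 4)\<^sup>2"
    using k by (intro divide_left_mono) auto
  also have "\<dots> = 16 / 9 * (r\<^sup>2 * M)" unfolding M_def by (simp add: power2_eq_square)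
  finally have 2: "(r * (1 + \<alpha> * r\<^sup>2))\<^sup>2 / k\<^sup>2 \<le> 16 / 9 * (r\<^sup>2 * M)" .
  have "r\<^sup>2 * M \<le> r\<^sup>2 * W" using WM by (intro mult_left_mono) auto
  moreover have "16 / 9 * r\<^sup>2 * W < W * W"
    using W r2 by (intro mult_strict_right_mono) linarith+
  ultimately have "r\<^sup>2 * (W - M) + 16 / 9 * (r\<^sup>2 * M) < W * W"
    unfolding right_diff_distrib mult.assoc by linarith
  moreover have "a + b - w < 0" if "a \<le> p" "b \<le> q" "p + q < w" for a b p q w :: real
    using that by simp
  moreover have "ellipse_gap \<alpha> r h k 0 =
      (r * ((\<alpha> - 1) * r))\<^sup>2 / h\<^sup>2 + (r * (1 + \<alpha> * r\<^sup>2))\<^sup>2 / k\<^sup>2 - W * W"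
    by (simp add: ellipse_gap_def W_def power2_eq_square[of "_ * _"])
  ultimately show ?thesis using 1 2 by metis
qed

text \<open>The parts even in c cancel, so the two gaps differ by 2 c d (2 D - e^2), and 2 D - e^2
  is a square plus a nonnegative term.\<close>

lemma ellipse_gap_reflect:
  assumes \<alpha>: "0 < \<alpha>" "\<alpha> < 1" and r: "0 < r" "r < 1" and c: "0 \<le> c" "c \<le> 1"
    and h: "h > 0" "r = h * ((1 - r) * (1 + \<alpha> * r))"
  shows "ellipse_gap \<alpha> r h k (- c) \<le> ellipse_gap \<alpha> r h k c"
proof -
  define d where "d = 2 * r * (1 - \<alpha>) * (1 - \<alpha> * r\<^sup>2)"
  define e where "e = (1 - r) * (1 + \<alpha> * r)"
  define D where "D = (1 + r\<^sup>2) * (1 + \<alpha>\<^sup>2 * r\<^sup>2) - 4 * \<alpha> * r\<^sup>2 * c\<^sup>2"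
  have "r\<^sup>2 < 1" using r by (simp add: power_less_one_iff)
  then have "\<alpha> * r\<^sup>2 < 1" using \<alpha> mult_strict_mono[of \<alpha> 1 "r\<^sup>2" 1] by simp
  then have d: "0 \<le> d" using \<alpha> r by (simp add: d_def)
  have "4 * \<alpha> * r\<^sup>2 * c\<^sup>2 \<le> 4 * \<alpha> * r\<^sup>2 * 1"
    using \<alpha> c by (intro mult_left_mono) (auto simp: power_le_one)
  moreover have "2 * ((1 + r\<^sup>2) * (1 + \<alpha>\<^sup>2 * r\<^sup>2) - 4 * \<alpha> * r\<^sup>2) = e\<^sup>2 + ((1 + r) * (1 - \<alpha> * r))\<^sup>2"
    unfolding e_def by algebra
  moreover have "2 * D = 2 * ((1 + r\<^sup>2) * (1 + \<alpha>\<^sup>2 * r\<^sup>2) - 4 * \<alpha> * r\<^sup>2)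
      + 2 * (4 * \<alpha> * r\<^sup>2 * 1 - 4 * \<alpha> * r\<^sup>2 * c\<^sup>2)" by (simp add: D_def)
  ultimately have "e\<^sup>2 \<le> 2 * D" by simp
  then have "0 \<le> 2 * c * d * (2 * D - e\<^sup>2)" using c d by simp
  moreover have "ellipse_gap \<alpha> r h k c - ellipse_gap \<alpha> r h k (- c) = 2 * c * d * (2 * D - e\<^sup>2)"
  proof -
    have "(e * ((\<alpha> - 1) * r + c * (1 - \<alpha> * r\<^sup>2)))\<^sup>2 - (e * ((\<alpha> - 1) * r + - c * (1 - \<alpha> * r\<^sup>2)))\<^sup>2
        = - 2 * c * d * e\<^sup>2" unfolding d_def by algebra
    moreover have "((1 + r\<^sup>2 - 2 * r * - c) * (1 + \<alpha>\<^sup>2 * r\<^sup>2 + 2 * \<alpha> * r * - c))\<^sup>2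
        - ((1 + r\<^sup>2 - 2 * r * c) * (1 + \<alpha>\<^sup>2 * r\<^sup>2 + 2 * \<alpha> * r * c))\<^sup>2 = 4 * c * d * D"
      unfolding d_def D_def by algebra
    ultimately show ?thesis
      unfolding ellipse_gap_eliminate[OF h] e_def[symmetric] by (simp add: algebra_simps)
  qed
  ultimately show ?thesis by linarith
qed

text \<open>The gap vanishes at c = 1, so a factor x = 1 - c splits off, with cofactor at most
  \<open>b\<close>. As \<alpha> tends to 0, r, e and M tend to 1/2, the numbers \<mu>, d and k to 1,
  and b to -1/4; the numerical windows perturb this limit.\<close>

lemma ellipse_gap_neg_small:
  assumes \<alpha>: "0 < \<alpha>" "\<alpha> \<le> 1 / 100" and r: "49 / 100 \<le> r" "r \<le> 51 / 100" and k: "99 / 100 \<le> k"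
    and h: "h > 0" "r = h * ((1 - r) * (1 + \<alpha> * r))" and c: "0 \<le> c" "c < 1"
  shows "ellipse_gap \<alpha> r h k c < 0"
proof -
  define x where "x = 1 - c"
  have x: "0 < x" "x \<le> 1" using c by (simp_all add: x_def)
  define d where "d = 2 * r * (1 - \<alpha>) * (1 - \<alpha> * r\<^sup>2)"
  define e where "e = (1 - r) * (1 + \<alpha> * r)"
  define \<mu> where "\<mu> = 1 - \<alpha> * r\<^sup>2"
  define M where "M = r * (1 + \<alpha> * r\<^sup>2)"
  have "r\<^sup>2 \<le> (51 / 100)\<^sup>2" using r by (intro power_mono) auto
  then have r2: "0 \<le> r\<^sup>2" "r\<^sup>2 \<le> 2601 / 10000" by (simp_all add: power2_eq_square)
  have ar: "0 \<le> \<alpha> * r" "\<alpha> * r \<le> 51 / 10000"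
    using mult_mono[of \<alpha> "1 / 100" r "51 / 100"] \<alpha> r by simp_all
  have ar2: "0 \<le> \<alpha> * r\<^sup>2" "\<alpha> * r\<^sup>2 \<le> 3 / 1000"
    using mult_mono[of \<alpha> "1 / 100" "r\<^sup>2" "2601 / 10000"] \<alpha> r2 by simp_all
  have e: "49 / 100 \<le> e" "e \<le> 52 / 100"
    using mult_mono[of "49 / 100" "1 - r" 1 "1 + \<alpha> * r"] mult_mono[of "1 - r" "51 / 100" "1 + \<alpha> * r" "10051 / 10000"]
      r ar by (simp_all add: e_def)
  have \<mu>: "997 / 1000 \<le> \<mu>" "\<mu> \<le> 1" using ar2 by (simp_all add: \<mu>_def)
  have M: "0 \<le> M" "M \<le> 512 / 1000"
    using mult_mono[of r "51 / 100" "1 + \<alpha> * r\<^sup>2" "1003 / 1000"] r ar2 by (simp_all add: M_def)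
  have d: "96 / 100 \<le> d"
  proof -
    have "98 / 100 * (99 / 100) * (997 / 1000) \<le> d"
      unfolding d_def \<mu>_def[symmetric] using r \<alpha> \<mu> by (intro mult_mono) auto
    then show ?thesis by simp
  qed
  have e2: "2401 / 10000 \<le> e\<^sup>2" "e\<^sup>2 \<le> 2704 / 10000"
    using power_mono[of "49 / 100" e 2] power_mono[of e "52 / 100" 2] e by (simp_all add: power2_eq_square)
  have e3: "11 / 100 \<le> e ^ 3 * \<mu>"
  proof -
    have "(49 / 100) ^ 3 * (997 / 1000) \<le> e ^ 3 * \<mu>"
      using e \<mu> by (intro mult_mono power_mono) auto
    then show ?thesis by (simp add: power3_eq_cube)
  qed
  have e2m: "e\<^sup>2 * \<mu>\<^sup>2 \<le> 2704 / 10000"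
    using mult_mono[OF e2(2), of "\<mu>\<^sup>2" 1] \<mu> by (simp add: power_le_one)
  have e2d: "23 / 100 \<le> e\<^sup>2 * d" using mult_mono[OF e2(1) d] by simp
  have Mk: "M\<^sup>2 / k\<^sup>2 \<le> 268 / 1000"
  proof -
    have "M\<^sup>2 / k\<^sup>2 \<le> (512 / 1000)\<^sup>2 / (99 / 100)\<^sup>2"
      using M k by (intro frac_le power_mono) auto
    then show ?thesis by (simp add: power2_eq_square)
  qed
  define b where "b = - 2 * (e ^ 3 * \<mu>) + e\<^sup>2 * \<mu>\<^sup>2 * x + M\<^sup>2 / k\<^sup>2 * (2 - x) - 2 * (e\<^sup>2 * d)"
  have "b < 0"
  proof -
    have "e\<^sup>2 * \<mu>\<^sup>2 * x \<le> 2704 / 10000 * x" using e2m x by (intro mult_right_mono) auto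
    moreover have "M\<^sup>2 / k\<^sup>2 * (2 - x) \<le> 268 / 1000 * (2 - x)" using Mk x by (intro mult_right_mono) auto
    moreover have "- 2 * p + q + s - 2 * t < 0"
      if "q \<le> 2704 / 10000 * x" "s \<le> 268 / 1000 * (2 - x)" "11 / 100 \<le> p" "23 / 100 \<le> t" for p q s t
      using that x by simp
    ultimately show ?thesis unfolding b_def using e3 e2d by blast
  qed
  have D: "e\<^sup>2 + d * x \<le> (1 + r\<^sup>2 - 2 * r * c) * (1 + \<alpha>\<^sup>2 * r\<^sup>2 + 2 * \<alpha> * r * c)"
  proof -
    have "(1 + r\<^sup>2 - 2 * r * c) * (1 + \<alpha>\<^sup>2 * r\<^sup>2 + 2 * \<alpha> * r * c)
        = e\<^sup>2 + d * x + 4 * \<alpha> * r\<^sup>2 * (x * (2 - x))"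
      unfolding e_def d_def x_def by algebra
    moreover have "0 \<le> 4 * \<alpha> * r\<^sup>2 * (x * (2 - x))" using \<alpha> x by simp
    ultimately show ?thesis by linarith
  qed
  have "e ^ 4 + 2 * (e\<^sup>2 * d) * x \<le> (e\<^sup>2 + d * x)\<^sup>2" by (simp add: power2_sum algebra_simps)
  also have "\<dots> \<le> ((1 + r\<^sup>2 - 2 * r * c) * (1 + \<alpha>\<^sup>2 * r\<^sup>2 + 2 * \<alpha> * r * c))\<^sup>2"
    using D d x by (intro power_mono) auto
  finally have D2: "e ^ 4 + 2 * (e\<^sup>2 * d) * x
      \<le> ((1 + r\<^sup>2 - 2 * r * c) * (1 + \<alpha>\<^sup>2 * r\<^sup>2 + 2 * \<alpha> * r * c))\<^sup>2" .
  have "(e * ((\<alpha> - 1) * r + c * (1 - \<alpha> * r\<^sup>2)))\<^sup>2 = e ^ 4 - 2 * (e ^ 3 * \<mu>) * x + e\<^sup>2 * \<mu>\<^sup>2 * x * x"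
    unfolding e_def \<mu>_def x_def by algebra
  moreover have "1 - c\<^sup>2 = (2 - x) * x" unfolding x_def by algebra
  then have "M\<^sup>2 * (1 - c\<^sup>2) / k\<^sup>2 = M\<^sup>2 / k\<^sup>2 * (2 - x) * x" by simp
  ultimately have "ellipse_gap \<alpha> r h k c =
      e ^ 4 - 2 * (e ^ 3 * \<mu>) * x + e\<^sup>2 * \<mu>\<^sup>2 * x * x + M\<^sup>2 / k\<^sup>2 * (2 - x) * x
      - ((1 + r\<^sup>2 - 2 * r * c) * (1 + \<alpha>\<^sup>2 * r\<^sup>2 + 2 * \<alpha> * r * c))\<^sup>2"
    unfolding ellipse_gap_eliminate[OF h] e_def[symmetric] M_def[symmetric] by (simp only:)
  moreover have "y - 2 * p * x + q * x * x + z * (2 - x) * x - g \<le> (- 2 * p + q * x + z * (2 - x) - 2 * t) * x"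
    if "y + 2 * t * x \<le> g" for y p q z t g :: real
    using that by (simp add: algebra_simps)
  ultimately have "ellipse_gap \<alpha> r h k c \<le> b * x"
    unfolding b_def using D2 by metis
  also have "\<dots> < 0" using \<open>b < 0\<close> x by (simp add: mult_neg_pos)
  finally show ?thesis .
qed

text \<open>For \<alpha> = 4/5 the curve is outside the ellipse near the vertex. The three final
  estimates leave a margin of only 0.00255, hence the narrow window for r.\<close>

lemma ellipse_gap_pos:
  assumes r: "677 / 1000 \<le> r" "r \<le> 682 / 1000" and k: "0 < k" "k \<le> 869 / 1000"
    and h: "h > 0" "r = h * ((1 - r) * (1 + 4 / 5 * r))"
  shows "0 < ellipse_gap (4 / 5) r h k (24 / 25)"
proof -
  have r2: "458 / 1000 \<le> r\<^sup>2" "r\<^sup>2 \<le> 4652 / 10000"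
    using power_mono[of "677 / 1000" r 2] power_mono[of r "682 / 1000" 2] r by (simp_all add: power2_eq_square)
  define e where "e = (1 - r) * (1 + 4 / 5 * r)"
  have "e = 1 - r / 5 - 4 / 5 * r\<^sup>2" unfolding e_def by (simp add: power2_eq_square field_simps)
  then have e: "491 / 1000 \<le> e" using r r2 by simp
  define t where "t = (4 / 5 - 1) * r + 24 / 25 * (1 - 4 / 5 * r\<^sup>2)"
  have t: "466 / 1000 \<le> t"
    unfolding t_def left_diff_distrib right_diff_distrib using r r2 by simp
  have "491 / 1000 * (466 / 1000) \<le> e * t" using e t by (intro mult_mono) auto
  then have "(491 / 1000 * (466 / 1000))\<^sup>2 \<le> (e * t)\<^sup>2" by (intro power_mono) auto
  then have 1: "5235 / 100000 \<le> (e * t)\<^sup>2" by (simp add: power2_eq_square)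
  define m where "m = r * (1 + 4 / 5 * r\<^sup>2)"
  have "677 / 1000 * (1366 / 1000) \<le> m" unfolding m_def using r r2 by (intro mult_mono) auto
  then have "(9247 / 10000)\<^sup>2 / (869 / 1000)\<^sup>2 \<le> m\<^sup>2 / k\<^sup>2"
    using k by (intro frac_le power_mono) auto
  then have "1132 / 1000 * (49 / 625) \<le> m\<^sup>2 / k\<^sup>2 * (49 / 625)"
    by (intro mult_right_mono) (simp_all add: power2_eq_square)
  moreover have "m\<^sup>2 * (1 - (24 / 25)\<^sup>2) / k\<^sup>2 = m\<^sup>2 / k\<^sup>2 * (49 / 625)" by (simp add: power2_eq_square)
  ultimately have 2: "887 / 10000 \<le> m\<^sup>2 * (1 - (24 / 25)\<^sup>2) / k\<^sup>2" by simp
  define p where "p = 1 + r\<^sup>2 - 2 * r * (24 / 25)"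
  define q where "q = 1 + (4 / 5)\<^sup>2 * r\<^sup>2 + 2 * (4 / 5) * r * (24 / 25)"
  have p: "0 \<le> p" "p \<le> 1586 / 10000"
  proof -
    have "p = (24 / 25 - r)\<^sup>2 + 49 / 625" unfolding p_def by (simp add: power2_eq_square algebra_simps)
    moreover have "(24 / 25 - r)\<^sup>2 \<le> (283 / 1000)\<^sup>2" using r by (intro power_mono) auto
    ultimately show "0 \<le> p" "p \<le> 1586 / 10000" by (simp_all add: power2_eq_square)
  qed
  have q: "0 \<le> q" "q \<le> 2346 / 1000" unfolding q_def using r r2 by (simp_all add: power2_eq_square)
  have "p * q \<le> 1586 / 10000 * (2346 / 1000)" using p q by (intro mult_mono) auto
  then have "(p * q)\<^sup>2 \<le> (1586 / 10000 * (2346 / 1000))\<^sup>2" using p q by (intro power_mono) auto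
  then have 3: "(p * q)\<^sup>2 \<le> 1385 / 10000" by (simp add: power2_eq_square)
  show ?thesis
    unfolding ellipse_gap_eliminate[OF h] e_def[symmetric] t_def[symmetric] m_def[symmetric]
      p_def[symmetric] q_def[symmetric]
    using 1 2 3 by linarith
qed

section \<open>The radius \<open>r0\<close>\<close>

text \<open>With s = (x / h1)^2 this is \<open>cosh_cos_ellipse\<close> for U = 2 \<alpha> h1 and V
  = 2 \<alpha> h2; cosh U and cos V are reciprocal since cosh U = (1 + \<alpha>^2) / (1 -
  \<alpha>^2). Being inside the ellipse means |2 \<alpha> y| < V sqrt (1 - s), and the decrease of
  cos supplies strictness.\<close>

lemma ellipse_in_psi_region_real:
  assumes \<alpha>: "0 < \<alpha>" "\<alpha> \<le> 4 / 5"
    and Q: "(x / h1 \<alpha>)\<^sup>2 + (y / h2 \<alpha>)\<^sup>2 < 1"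
  shows "2 * \<alpha> * \<bar>y\<bar> < pi" "(1 - \<alpha>\<^sup>2) * cosh (2 * \<alpha> * x) < (1 + \<alpha>\<^sup>2) * cos (2 * \<alpha> * y)"
proof -
  have \<alpha>1: "\<alpha> < 1" using \<alpha> by simp
  note h = h1_h2_pos[OF \<alpha>(1) \<alpha>1]
  define U where "U = 2 * artanh \<alpha>"
  define V where "V = 2 * arctan \<alpha>"
  have Uh: "U = 2 * \<alpha> * h1 \<alpha>" and Vh: "V = 2 * \<alpha> * h2 \<alpha>"
    using \<alpha> by (simp_all add: U_def V_def h1_eq h2_eq[OF \<alpha>(1) \<alpha>1])
  have U: "0 < U" and V: "0 < V" using h \<alpha> by (simp_all add: Uh Vh)
  have "arctan \<alpha> \<le> arctan (4 / 5)" using \<alpha> by (simp add: arctan_le_iff)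
  also have "\<dots> \<le> 4 / 5 - (4 / 5) ^ 3 / 3 + (4 / 5) ^ 5 / 5" by (rule arctan_le_taylor5) simp
  finally have V2: "V \<le> 139 / 100" by (simp add: V_def eval_nat_numeral)
  have Vpi: "V < pi / 2" using V2 pi_gt3 by linarith
  have p: "0 < 1 - \<alpha>\<^sup>2" using \<alpha> \<alpha>1 by (simp add: power_less_one_iff)
  have p': "0 < 1 + \<alpha>\<^sup>2" by (simp add: add_pos_nonneg)
  have cU: "(1 - \<alpha>\<^sup>2) * cosh U = 1 + \<alpha>\<^sup>2"
    unfolding U_def by (rule cosh_double_artanh[OF \<alpha>(1) \<alpha>1])
  have cV: "cos V = (1 - \<alpha>\<^sup>2) / (1 + \<alpha>\<^sup>2)" unfolding V_def by (rule sin_cos_double_arctan)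
  have "cosh U = (1 + \<alpha>\<^sup>2) / (1 - \<alpha>\<^sup>2)" using cU p by (simp add: field_simps)
  then have ends: "cosh U * cos V = 1" using cV p p' by simp
  have UV: "1 / V\<^sup>2 - 1 / U\<^sup>2 \<le> 2 / 5"
    using inverse_square_arctan_artanh[OF \<alpha>] by (simp add: U_def V_def power_mult_distrib)
  define s where "s = (x / h1 \<alpha>)\<^sup>2"
  have s: "0 \<le> s" "(y / h2 \<alpha>)\<^sup>2 < 1 - s" using Q by (simp_all add: s_def)
  then have s1: "s \<le> 1" using zero_le_power2[of "y / h2 \<alpha>"] by linarith
  have Us: "U * sqrt s = \<bar>2 * \<alpha> * x\<bar>" using \<alpha> h by (simp add: s_def Uh abs_mult)
  have "\<bar>y / h2 \<alpha>\<bar> < sqrt (1 - s)" using s(2) by (intro real_less_rsqrt) (simp only: power2_abs)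
  then have "V * \<bar>y / h2 \<alpha>\<bar> < V * sqrt (1 - s)" using V by (rule mult_strict_left_mono)
  moreover have "V * \<bar>y / h2 \<alpha>\<bar> = \<bar>2 * \<alpha> * y\<bar>" using \<alpha> h by (simp add: Vh abs_mult)
  ultimately have Vs: "\<bar>2 * \<alpha> * y\<bar> < V * sqrt (1 - s)" by simp
  have Vs1: "V * sqrt (1 - s) \<le> V" using V s s1 by (intro mult_left_le) auto
  have "2 * \<alpha> * \<bar>y\<bar> = \<bar>2 * \<alpha> * y\<bar>" using \<alpha> by (simp add: abs_mult)
  then show "2 * \<alpha> * \<bar>y\<bar> < pi" using Vs Vs1 Vpi by linarith
  have "cos (V * sqrt (1 - s)) < cos \<bar>2 * \<alpha> * y\<bar>"
    using Vs Vs1 Vpi by (intro cos_monotone_0_pi) auto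
  then have c: "cos (V * sqrt (1 - s)) < cos (2 * \<alpha> * y)" by (simp only: cos_abs_real)
  have "cosh (2 * \<alpha> * x) = cosh (U * sqrt s)" unfolding Us by (simp only: cosh_real_abs)
  also have "\<dots> \<le> cosh U * cos (V * sqrt (1 - s))"
    by (rule cosh_cos_ellipse[OF U V V2 UV ends s(1) s1])
  finally have "(1 - \<alpha>\<^sup>2) * cosh (2 * \<alpha> * x) \<le> (1 - \<alpha>\<^sup>2) * (cosh U * cos (V * sqrt (1 - s)))"
    using p by simp
  also have "\<dots> = (1 + \<alpha>\<^sup>2) * cos (V * sqrt (1 - s))" by (simp only: cU mult.assoc[symmetric])
  also have "\<dots> < (1 + \<alpha>\<^sup>2) * cos (2 * \<alpha> * y)" using c p' by simp
  finally show "(1 - \<alpha>\<^sup>2) * cosh (2 * \<alpha> * x) < (1 + \<alpha>\<^sup>2) * cos (2 * \<alpha> * y)" .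
qed

lemma kphi_Re_Im:
  fixes z :: complex
  assumes \<alpha>: "0 < \<alpha>" "\<alpha> < 1" and z: "norm z = r" "r < 1"
  defines "d \<equiv> (1 + r\<^sup>2 - 2 * Re z) * (1 + \<alpha>\<^sup>2 * r\<^sup>2 + 2 * \<alpha> * Re z)"
  shows "0 < d" "Re (kphi \<alpha> z) = (Re z * (1 - \<alpha> * r\<^sup>2) + (\<alpha> - 1) * r\<^sup>2) / d"
    "Im (kphi \<alpha> z) = Im z * (1 + \<alpha> * r\<^sup>2) / d"
proof -
  have r2: "r\<^sup>2 = (Re z)\<^sup>2 + (Im z)\<^sup>2" using z by (simp add: cmod_power2[symmetric])
  define w where "w = (1 - z) * (1 + of_real \<alpha> * z)"
  have w0: "w \<noteq> 0" using kphi_denom_nonzero[OF \<alpha>, of z] z by (simp add: w_def)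
  have Rw: "Re w = (1 - Re z) * (1 + \<alpha> * Re z) + \<alpha> * (Im z)\<^sup>2"
    and Iw: "Im w = (1 - Re z) * (\<alpha> * Im z) - Im z * (1 + \<alpha> * Re z)"
    by (simp_all add: w_def power2_eq_square)
  have d: "d = (Re w)\<^sup>2 + (Im w)\<^sup>2" unfolding d_def r2 Rw Iw by algebra
  then show "0 < d" using w0 by (simp add: complex_neq_0)
  have k: "kphi \<alpha> z = z / w" by (simp add: kphi_def w_def)
  have "Re z * Re w + Im z * Im w = Re z * (1 - \<alpha> * r\<^sup>2) + (\<alpha> - 1) * r\<^sup>2"
    unfolding r2 Rw Iw by algebra
  then show "Re (kphi \<alpha> z) = (Re z * (1 - \<alpha> * r\<^sup>2) + (\<alpha> - 1) * r\<^sup>2) / d"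
    unfolding k d Re_divide by simp
  have "Im z * Re w - Re z * Im w = Im z * (1 + \<alpha> * r\<^sup>2)"
    unfolding r2 Rw Iw by algebra
  then show "Im (kphi \<alpha> z) = Im z * (1 + \<alpha> * r\<^sup>2) / d"
    unfolding k d Im_divide by simp
qed

lemma kphi_circle_in_ellipse:
  fixes z :: complex
  assumes \<alpha>: "0 < \<alpha>" "\<alpha> < 1" and z: "norm z = r" "0 < r" "r < 1"
    and gap: "ellipse_gap \<alpha> r h k (Re z / r) \<le> 0"
  shows "(Re (kphi \<alpha> z) / h)\<^sup>2 + (Im (kphi \<alpha> z) / k)\<^sup>2 \<le> 1"
proof -
  define c where "c = Re z / r"
  have Rz: "Re z = r * c" using z by (simp add: c_def)
  have r2: "r\<^sup>2 = (Re z)\<^sup>2 + (Im z)\<^sup>2" using z by (simp add: cmod_power2[symmetric])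
  then have Iz: "(Im z)\<^sup>2 = r\<^sup>2 * (1 - c\<^sup>2)" unfolding Rz by (simp add: power_mult_distrib algebra_simps)
  define d where "d = (1 + r\<^sup>2 - 2 * r * c) * (1 + \<alpha>\<^sup>2 * r\<^sup>2 + 2 * \<alpha> * r * c)"
  have "d = (1 + r\<^sup>2 - 2 * Re z) * (1 + \<alpha>\<^sup>2 * r\<^sup>2 + 2 * \<alpha> * Re z)" by (simp add: d_def Rz mult.assoc)
  note k = kphi_Re_Im[OF \<alpha> z(1,3), folded this]
  define p where "p = r * ((\<alpha> - 1) * r + c * (1 - \<alpha> * r\<^sup>2))"
  have R: "Re (kphi \<alpha> z) = p / d" unfolding k(2) Rz p_def by (simp add: power2_eq_square algebra_simps)
  have "(Im z * (1 + \<alpha> * r\<^sup>2))\<^sup>2 = (r * (1 + \<alpha> * r\<^sup>2))\<^sup>2 * (1 - c\<^sup>2)"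
    unfolding power_mult_distrib Iz by (simp add: mult_ac)
  then have I: "(Im (kphi \<alpha> z) / k)\<^sup>2 = (r * (1 + \<alpha> * r\<^sup>2))\<^sup>2 * (1 - c\<^sup>2) / k\<^sup>2 / d\<^sup>2"
    unfolding k(3) power_divide by simp
  have "(Re (kphi \<alpha> z) / h)\<^sup>2 + (Im (kphi \<alpha> z) / k)\<^sup>2
      = (p\<^sup>2 / h\<^sup>2 + (r * (1 + \<alpha> * r\<^sup>2))\<^sup>2 * (1 - c\<^sup>2) / k\<^sup>2) / d\<^sup>2"
    unfolding I unfolding R by (simp add: power_divide add_divide_distrib power_mult_distrib)
  also have "\<dots> \<le> 1"
  proof -
    have "p\<^sup>2 / h\<^sup>2 + (r * (1 + \<alpha> * r\<^sup>2))\<^sup>2 * (1 - c\<^sup>2) / k\<^sup>2 \<le> d\<^sup>2"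
      using gap unfolding ellipse_gap_def c_def[symmetric] p_def[symmetric] d_def[symmetric] by simp
    then show ?thesis using k(1) by (simp add: pos_divide_le_eq)
  qed
  finally show ?thesis .
qed

text \<open>The quadratic form is not the real part of a holomorphic function, so the maximum
  principle is applied to Re (m \<open>kphi\<close>) with m adapted to z: it equals the value Q of
  the form at z and is at most (Q + 1) / 2 on the circle, whence Q \<le> 1. For strictness, openness
  puts (1 + t) w in the image for some t > 0.\<close>

lemma kphi_disc_in_ellipse:
  fixes z :: complex
  assumes \<alpha>: "0 < \<alpha>" "\<alpha> < 1" and r: "0 < r" "r < 1" and hk: "0 < h" "0 < k"
    and circle: "\<And>z. norm z = r \<Longrightarrow> (Re (kphi \<alpha> z) / h)\<^sup>2 + (Im (kphi \<alpha> z) / k)\<^sup>2 \<le> 1"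
    and z: "norm z < r"
  shows "(Re (kphi \<alpha> z) / h)\<^sup>2 + (Im (kphi \<alpha> z) / k)\<^sup>2 < 1"
proof -
  define Q where "Q w = (Re w / h)\<^sup>2 + (Im w / k)\<^sup>2" for w
  have hol: "kphi \<alpha> holomorphic_on ball 0 1" by (rule holomorphic_kphi[OF \<alpha>])
  have le: "Q (kphi \<alpha> z) \<le> 1" if z: "norm z < r" for z
  proof -
    define a where "a = Re (kphi \<alpha> z) / h"
    define b where "b = Im (kphi \<alpha> z) / k"
    define m where "m = Complex (a / h) (- (b / k))"
    have Rem: "Re (m * w) = a * (Re w / h) + b * (Im w / k)" for w by (simp add: m_def)
    have "Re (m * kphi \<alpha> z) \<le> (a\<^sup>2 + b\<^sup>2 + 1) / 2"
    proof (rule maximum_real_frontier[of "\<lambda>z. m * kphi \<alpha> z" "ball 0 r"])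
      show "(\<lambda>z. m * kphi \<alpha> z) holomorphic_on interior (ball 0 r)"
        using r by (intro holomorphic_intros holomorphic_on_subset[OF hol]) auto
      have "continuous_on (cball 0 r) (kphi \<alpha>)"
        using r by (intro holomorphic_on_imp_continuous_on holomorphic_on_subset[OF hol]) auto
      then show "continuous_on (closure (ball 0 r)) (\<lambda>z. m * kphi \<alpha> z)"
        using r by (auto intro!: continuous_intros)
      fix \<zeta> :: complex assume "\<zeta> \<in> frontier (ball 0 r)"
      then have "norm \<zeta> = r" using r by simp
      from circle[OF this]
      have "(Re (kphi \<alpha> \<zeta>) / h)\<^sup>2 + (Im (kphi \<alpha> \<zeta>) / k)\<^sup>2 \<le> 1" .
      moreover have "a * x + b * y \<le> (a\<^sup>2 + b\<^sup>2 + (x\<^sup>2 + y\<^sup>2)) / 2" for x y :: real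
        using sum_squares_bound[of a x] sum_squares_bound[of b y] by simp
      ultimately show "Re (m * kphi \<alpha> \<zeta>) \<le> (a\<^sup>2 + b\<^sup>2 + 1) / 2"
        unfolding Rem by (smt (verit) divide_right_mono)
    qed (use z in auto)
    moreover have "Re (m * kphi \<alpha> z) = a\<^sup>2 + b\<^sup>2"
      unfolding Rem by (simp add: a_def b_def power2_eq_square)
    ultimately show ?thesis by (simp add: Q_def a_def b_def)
  qed
  have "open (kphi \<alpha> ` ball 0 r)"
  proof (rule open_mapping_thm[OF holomorphic_on_subset[OF hol]])
    show "\<not> kphi \<alpha> constant_on ball 0 r"
    proof
      assume "kphi \<alpha> constant_on ball 0 r"
      then obtain C where C: "\<And>z. z \<in> ball 0 r \<Longrightarrow> kphi \<alpha> z = C" by (auto simp: constant_on_def)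
      have "kphi \<alpha> (of_real (r / 2)) = kphi \<alpha> 0" using C[of 0] C[of "of_real (r / 2)"] r by simp
      then show False
        using kphi_denom_nonzero[OF \<alpha>, of "of_real (r / 2)"] r by (simp add: kphi_def)
    qed
  qed (use r in auto)
  moreover define w where "w = kphi \<alpha> z"
  then have "w \<in> kphi \<alpha> ` ball 0 r" using z by auto
  ultimately obtain \<epsilon> where \<epsilon>: "0 < \<epsilon>" "cball w \<epsilon> \<subseteq> kphi \<alpha> ` ball 0 r"
    using open_contains_cball by blast
  define t where "t = \<epsilon> / (norm w + 1)"
  have n: "0 < norm w + 1" by (simp add: add_nonneg_pos)
  have t: "0 < t" using \<epsilon> n by (simp add: t_def)
  have "t * norm w \<le> t * (norm w + 1)" using t by simp
  also have "\<dots> = \<epsilon>" using n by (simp add: t_def)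
  finally have "w + of_real t * w \<in> cball w \<epsilon>" using t by (simp add: dist_norm norm_mult)
  then obtain z' where z': "norm z' < r" "w + of_real t * w = kphi \<alpha> z'" using \<epsilon>(2) by auto
  have "Q (w + of_real t * w) \<le> 1" unfolding z'(2) by (rule le[OF z'(1)])
  moreover have "Q (w + of_real t * w) = (1 + t)\<^sup>2 * Q w"
    by (simp add: Q_def power_divide algebra_simps power2_eq_square add_divide_distrib)
  ultimately have l: "(1 + t)\<^sup>2 * Q w \<le> 1" by simp
  have "Q w < 1"
  proof (rule ccontr)
    assume "\<not> Q w < 1"
    then have "(1 + t)\<^sup>2 * 1 \<le> (1 + t)\<^sup>2 * Q w" by (intro mult_left_mono) auto
    moreover have "1 < (1 + t)\<^sup>2" using t by (simp add: power2_eq_square algebra_simps add_pos_pos)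
    ultimately show False using l by linarith
  qed
  then show ?thesis by (simp add: Q_def w_def)
qed

section \<open>The threshold \<open>alpha0\<close>\<close>

definition r0_gap :: "real \<Rightarrow> real \<Rightarrow> real" where
  "r0_gap \<alpha> c = ellipse_gap \<alpha> (r0 \<alpha>) (h1 \<alpha>) (h2 \<alpha>) c"

lemma alpha0_solutions_iff:
  "\<alpha> \<in> alpha0_solutions \<longleftrightarrow> 0 < \<alpha> \<and> \<alpha> < 1 \<and> (\<exists>c. 0 < c \<and> c < 1 \<and> r0_gap \<alpha> c = 0)"
proof -
  have "(\<exists>\<theta>. 0 < \<theta> \<and> \<theta> < pi / 2 \<and> r0_gap \<alpha> (cos \<theta>) = 0) \<longleftrightarrow> (\<exists>c. 0 < c \<and> c < 1 \<and> r0_gap \<alpha> c = 0)"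
  proof safe
    fix \<theta> :: real assume \<theta>: "0 < \<theta>" "\<theta> < pi / 2" and g: "r0_gap \<alpha> (cos \<theta>) = 0"
    have "0 < cos \<theta>" using \<theta> by (intro cos_gt_zero)
    moreover have "cos \<theta> < 1" using cos_monotone_0_pi[of 0 \<theta>] \<theta> by simp
    ultimately show "\<exists>c. 0 < c \<and> c < 1 \<and> r0_gap \<alpha> c = 0" using g by blast
  next
    fix c :: real assume c: "0 < c" "c < 1" and g: "r0_gap \<alpha> c = 0"
    have "0 < arccos c" "arccos c < pi / 2"
      using c arccos_less_arccos[of c 1] arccos_less_arccos[of 0 c] by simp_all
    moreover have "cos (arccos c) = c" using c by simp
    ultimately show "\<exists>\<theta>. 0 < \<theta> \<and> \<theta> < pi / 2 \<and> r0_gap \<alpha> (cos \<theta>) = 0" using g by metis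
  qed
  then show ?thesis by (auto simp: alpha0_solutions_def alpha0_equation_iff_gap r0_gap_def)
qed

lemma h1_h2_bounds:
  assumes "0 < \<alpha>" "\<alpha> < 1"
  shows "1 \<le> h1 \<alpha>" "3 / (3 + \<alpha>\<^sup>2) \<le> h2 \<alpha>" "3 / 4 \<le> h2 \<alpha>"
proof -
  show "1 \<le> h1 \<alpha>" unfolding h1_eq using artanh_ge[of \<alpha>] assms by simp
  have "3 / (3 + \<alpha>\<^sup>2) = 3 * \<alpha> / (3 + \<alpha>\<^sup>2) / \<alpha>" using assms by simp
  also have "\<dots> \<le> arctan \<alpha> / \<alpha>"
    using assms by (intro divide_right_mono arctan_ge_rational) auto
  finally show 1: "3 / (3 + \<alpha>\<^sup>2) \<le> h2 \<alpha>" using h2_eq[OF assms] by simp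
  have "\<alpha>\<^sup>2 \<le> 1" using assms by (simp add: power_le_one)
  then have "3 / 4 \<le> 3 / (3 + \<alpha>\<^sup>2)" by (intro divide_left_mono) (auto intro: add_pos_nonneg)
  then show "3 / 4 \<le> h2 \<alpha>" using 1 by simp
qed

lemma r0:
  assumes "0 < \<alpha>" "\<alpha> < 1"
  shows "0 < r0 \<alpha>" "r0 \<alpha> < 1" "r0 \<alpha> = h1 \<alpha> * ((1 - r0 \<alpha>) * (1 + \<alpha> * r0 \<alpha>))"
  using cs_radius[OF assms h1_h2_pos(1)[OF assms]] by (simp_all add: r0_def)

text \<open>Brackets \<open>r0\<close> by comparing kernel values with \<open>h1\<close>, so that
  its square root is never evaluated.\<close>

lemma r0_bounds:
  assumes \<alpha>: "0 < \<alpha>" "\<alpha> < 1" and t: "0 \<le> t" "t < 1"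
  shows "h1 \<alpha> \<le> t / ((1 - t) * (1 + \<alpha> * t)) \<Longrightarrow> r0 \<alpha> \<le> t"
    and "t / ((1 - t) * (1 + \<alpha> * t)) \<le> h1 \<alpha> \<Longrightarrow> t \<le> r0 \<alpha>"
proof -
  note r = cs_radius[OF \<alpha> h1_h2_pos(1)[OF \<alpha>], folded r0_def]
  show "h1 \<alpha> \<le> t / ((1 - t) * (1 + \<alpha> * t)) \<Longrightarrow> r0 \<alpha> \<le> t"
    using cs_kernel_strict_mono[OF \<alpha>(1) t(1) _ r(2)] r(4) by fastforce
  show "t / ((1 - t) * (1 + \<alpha> * t)) \<le> h1 \<alpha> \<Longrightarrow> t \<le> r0 \<alpha>"
    using cs_kernel_strict_mono[OF \<alpha>(1) less_imp_le[OF r(1)] _ t(2)] r(4) by fastforce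
qed

lemma continuous_on_r0_gap: "continuous_on S (r0_gap \<alpha>)"
  unfolding r0_gap_def ellipse_gap_def divide_inverse by (intro continuous_intros)

text \<open>The gap is negative at c = 0, so the intermediate value theorem yields a zero in
  between.\<close>

lemma r0_gap_pos_imp_solution:
  assumes \<alpha>: "0 < \<alpha>" "\<alpha> < 1" and c: "0 < c" "c < 1" and pos: "0 < r0_gap \<alpha> c"
  shows "\<alpha> \<in> alpha0_solutions"
proof -
  have neg: "r0_gap \<alpha> 0 < 0"
    unfolding r0_gap_def by (intro ellipse_gap_at_0 \<alpha> r0[OF \<alpha>] h1_h2_bounds[OF \<alpha>])
  obtain x where "0 \<le> x" "x \<le> c" "r0_gap \<alpha> x = 0"
    using IVT'[of "r0_gap \<alpha>" 0 0 c] neg pos c continuous_on_r0_gap by auto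
  moreover have "x \<noteq> 0" using neg \<open>r0_gap \<alpha> x = 0\<close> by auto
  ultimately show ?thesis unfolding alpha0_solutions_iff using \<alpha> c by (intro conjI exI[of _ x]) auto
qed

lemma solution_bounds:
  shows "4 / 5 \<in> alpha0_solutions" "\<And>\<alpha>. \<alpha> \<in> alpha0_solutions \<Longrightarrow> 1 / 100 \<le> \<alpha>"
proof -
  define a :: real where "a = 4 / 5"
  have a: "0 < a" "a < 1" by (simp_all add: a_def)
  have "artanh a = ln ((1 + a) / (1 - a)) / 2" by (simp add: artanh_def)
  \<comment> \<open>The square halves the work: artanh (4/5) = 2 artanh (1/2), and at 1/2 the Taylor
    and rational bounds are much tighter.\<close>
  also have "(1 + a) / (1 - a) = (3::real) ^ 2" by (simp add: a_def)
  also have "ln ((3::real) ^ 2) / 2 = 2 * artanh (1 / 2)" by (subst ln_realpow) (simp_all add: artanh_def)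
  finally have A: "artanh a = 2 * artanh (1 / 2)" .
  have lo: "1 / 2 + (1 / 2) ^ 3 / 3 + (1 / 2) ^ 5 / 5 \<le> artanh (1 / 2 :: real)"
    by (rule artanh_ge_taylor5) simp_all
  have hi: "artanh (1 / 2 :: real) \<le> 1 / 2 / (1 - (1 / 2)\<^sup>2 / 3 - (1 / 2) ^ 4 / 5)"
    by (rule artanh_le_rational) simp_all
  have h: "1369 / 1000 \<le> h1 a" "h1 a \<le> 1383 / 1000"
    using lo hi unfolding h1_eq A by (simp_all add: a_def eval_nat_numeral field_simps)
  have r: "677 / 1000 \<le> r0 a" "r0 a \<le> 682 / 1000"
  proof -
    show "677 / 1000 \<le> r0 a"
      by (rule r0_bounds(2)[OF a]) (use h in \<open>simp_all add: a_def\<close>)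
    show "r0 a \<le> 682 / 1000"
      by (rule r0_bounds(1)[OF a]) (use h in \<open>simp_all add: a_def\<close>)
  qed
  have "arctan a \<le> a - a ^ 3 / 3 + a ^ 5 / 5" using a by (intro arctan_le_taylor5) simp
  then have k: "h2 a \<le> 869 / 1000" unfolding h2_eq[OF a] by (simp add: a_def eval_nat_numeral field_simps)
  have "0 < r0_gap a (24 / 25)"
    using ellipse_gap_pos[OF r h1_h2_pos(2)[OF a] k h1_h2_pos(1)[OF a]] r0(3)[OF a]
    unfolding r0_gap_def a_def by blast
  from r0_gap_pos_imp_solution[OF a _ _ this] show "4 / 5 \<in> alpha0_solutions" by (simp add: a_def)
next
  fix \<alpha> assume "\<alpha> \<in> alpha0_solutions"
  then obtain c where \<alpha>: "0 < \<alpha>" "\<alpha> < 1" and c: "0 < c" "c < 1" "r0_gap \<alpha> c = 0"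
    unfolding alpha0_solutions_iff by blast
  show "1 / 100 \<le> \<alpha>"
  proof (rule ccontr)
    assume "\<not> 1 / 100 \<le> \<alpha>"
    then have s: "\<alpha> \<le> 1 / 100" by simp
    have a2: "\<alpha>\<^sup>2 \<le> 1 / 10000" using power_mono[OF s, of 2] \<alpha> by (simp add: power2_eq_square)
    have a4: "\<alpha> ^ 4 \<le> 1 / 10000" using power_mono[OF s, of 4] \<alpha> by (simp add: eval_nat_numeral)
    have "h1 \<alpha> \<le> \<alpha> / (1 - \<alpha>\<^sup>2 / 3 - \<alpha> ^ 4 / 5) / \<alpha>"
      unfolding h1_eq using \<alpha> s by (intro divide_right_mono artanh_le_rational) auto
    also have "\<dots> = 1 / (1 - \<alpha>\<^sup>2 / 3 - \<alpha> ^ 4 / 5)" using \<alpha> by simp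
    also have "\<dots> \<le> 1 / (99 / 100)" using a2 a4 by (intro divide_left_mono) auto
    finally have h: "h1 \<alpha> \<le> 100 / 99" by simp
    \<comment> \<open>As \<alpha> tends to 0 the kernel becomes z / (1 - z) and \<open>h1\<close>
      tends to 1, so \<open>r0\<close> tends to 1/2.\<close>
    have r1: "49 / 100 \<le> r0 \<alpha>"
    proof (rule r0_bounds(2)[OF \<alpha>])
      have "49 / 100 / ((1 - 49 / 100) * (1 + \<alpha> * (49 / 100))) \<le> 49 / 100 / (51 / 100 * 1)"
        using \<alpha> by (intro divide_left_mono mult_mono) (auto intro!: mult_pos_pos add_pos_pos)
      also have "\<dots> \<le> h1 \<alpha>" using h1_h2_bounds(1)[OF \<alpha>] by simp
      finally show "49 / 100 / ((1 - 49 / 100) * (1 + \<alpha> * (49 / 100))) \<le> h1 \<alpha>" .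
    qed simp_all
    have r2: "r0 \<alpha> \<le> 51 / 100"
    proof (rule r0_bounds(1)[OF \<alpha>])
      have "h1 \<alpha> \<le> 51 / 100 / (49 / 100 * (10051 / 10000))" using h by simp
      also have "\<dots> \<le> 51 / 100 / ((1 - 51 / 100) * (1 + \<alpha> * (51 / 100)))"
        using \<alpha> s by (intro divide_left_mono mult_mono) (auto intro!: mult_pos_pos add_pos_pos)
      finally show "h1 \<alpha> \<le> 51 / 100 / ((1 - 51 / 100) * (1 + \<alpha> * (51 / 100)))" .
    qed simp_all
    have "99 / 100 \<le> 3 / (3 + \<alpha>\<^sup>2)" using a2 by (simp add: pos_le_divide_eq add_pos_nonneg)
    then have k: "99 / 100 \<le> h2 \<alpha>" using h1_h2_bounds(2)[OF \<alpha>] by simp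
    have "r0_gap \<alpha> c < 0"
      unfolding r0_gap_def
      by (rule ellipse_gap_neg_small[OF \<alpha>(1) s r1 r2 k h1_h2_pos(1)[OF \<alpha>] r0(3)[OF \<alpha>]])
         (use c in auto)
    then show False using c by simp
  qed
qed

lemma alpha0_bounds: "0 < alpha0" "alpha0 \<le> 4 / 5"
proof -
  have "1 / 100 \<le> alpha0"
    unfolding alpha0_def using solution_bounds by (intro cInf_greatest) auto
  then show "0 < alpha0" by simp
  show "alpha0 \<le> 4 / 5"
    unfolding alpha0_def using solution_bounds by (intro cInf_lower bdd_belowI)
qed

lemma isCont_r0_gap:
  assumes "0 < a" "a < 1"
  shows "isCont (\<lambda>\<alpha>. r0_gap \<alpha> c) a"
proof -
  have p: "0 < 1 + a\<^sup>2" by (simp add: add_pos_nonneg)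
  then have sq: "1 + a\<^sup>2 \<noteq> 0" by linarith
  have lt: "- 1 < 2 * a / (1 + a\<^sup>2)" "2 * a / (1 + a\<^sup>2) < 1"
  proof -
    have "0 \<le> 2 * a / (1 + a\<^sup>2)" using assms p by simp
    then show "- 1 < 2 * a / (1 + a\<^sup>2)" by linarith
    have "0 < (1 - a)\<^sup>2" using assms by simp
    then have "2 * a < 1 + a\<^sup>2" by (simp add: power2_eq_square algebra_simps)
    then show "2 * a / (1 + a\<^sup>2) < 1" using p by simp
  qed
  have h1: "isCont h1 a"
    unfolding h1_def[abs_def] using assms by (auto intro!: continuous_intros)
  have h2: "isCont h2 a"
    unfolding h2_def[abs_def]
    by (intro continuous_intros isCont_o2[OF _ isCont_arcsin]) (use assms sq lt in auto)
  have r: "isCont r0 a"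
    unfolding r0_def[abs_def] cs_radius_def[abs_def]
    using h1 h1_h2_pos[OF assms] assms by (intro continuous_intros) auto
  show ?thesis
    unfolding r0_gap_def[abs_def] ellipse_gap_def[abs_def]
    using h1 h2 r h1_h2_pos[OF assms] by (intro continuous_intros) auto
qed

text \<open>For 0 < c < 1 a positive gap would persist for parameters slightly below \<alpha>, which
  would then be solutions below \<open>alpha0\<close>; this treats \<alpha> = \<open>alpha0\<close>
  together with the smaller values. Negative c follow by reflection.\<close>

lemma r0_gap_nonpos:
  assumes \<alpha>: "0 < \<alpha>" "\<alpha> \<le> alpha0" and c: "- 1 \<le> c" "c \<le> 1"
  shows "r0_gap \<alpha> c \<le> 0"
proof -
  have \<alpha>1: "\<alpha> < 1" using \<alpha> alpha0_bounds by simp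
  note hr = h1_h2_pos(1)[OF \<alpha>(1) \<alpha>1] r0(3)[OF \<alpha>(1) \<alpha>1]
  have mid: "r0_gap \<alpha> c \<le> 0" if c: "0 < c" "c < 1" for c
  proof (rule ccontr)
    assume "\<not> r0_gap \<alpha> c \<le> 0"
    then have "0 < r0_gap \<alpha> c" by simp
    with isCont_r0_gap[OF \<alpha>(1) \<alpha>1, of c]
    have "\<forall>\<^sub>F b in at \<alpha>. 0 < r0_gap b c" unfolding isCont_def by (rule order_tendstoD)
    then have "\<forall>\<^sub>F b in at_left \<alpha>. 0 < r0_gap b c" by (rule filter_leD[rotated]) (simp add: at_le)
    moreover have "\<forall>\<^sub>F b in at_left \<alpha>. b \<in> {0<..<\<alpha>}" using \<alpha> by (intro eventually_at_left_real)
    ultimately have "\<forall>\<^sub>F b in at_left \<alpha>. 0 < r0_gap b c \<and> b \<in> {0<..<\<alpha>}" by eventually_elim simp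
    then obtain b where b: "0 < r0_gap b c" "0 < b" "b < \<alpha>"
      using eventually_happens'[of "at_left \<alpha>"] by auto
    have "b \<in> alpha0_solutions"
      using b \<alpha>1 c by (intro r0_gap_pos_imp_solution[of b c]) auto
    then have "alpha0 \<le> b"
      unfolding alpha0_def using solution_bounds by (intro cInf_lower bdd_belowI)
    then show False using b \<alpha> by simp
  qed
  have "r0_gap \<alpha> 0 < 0"
    unfolding r0_gap_def by (intro ellipse_gap_at_0 \<alpha> \<alpha>1 r0 h1_h2_bounds)
  moreover have "r0_gap \<alpha> 1 = 0" unfolding r0_gap_def by (rule ellipse_gap_at_1[OF hr])
  ultimately have nn: "r0_gap \<alpha> c \<le> 0" if "0 \<le> c" "c \<le> 1" for c
    using mid[of c] that by (cases "c = 0"; cases "c = 1") auto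
  show ?thesis
  proof (cases "0 \<le> c")
    case False
    have "r0_gap \<alpha> (- (- c)) \<le> r0_gap \<alpha> (- c)"
      unfolding r0_gap_def
      by (rule ellipse_gap_reflect[OF \<alpha>(1) \<alpha>1 r0(1,2)[OF \<alpha>(1) \<alpha>1] _ _ hr]) (use False c in auto)
    also have "\<dots> \<le> 0" using False c by (intro nn) auto
    finally show ?thesis by simp
  qed (use nn c in auto)
qed

lemma F_radius_valid_r0:
  assumes \<alpha>: "0 < \<alpha>" "\<alpha> \<le> alpha0"
  shows "F_radius_valid \<alpha> (of_real \<alpha>) (- of_real \<alpha>) (r0 \<alpha>)"
proof -
  have \<alpha>': "\<alpha> \<le> 4 / 5" "\<alpha> < 1" using \<alpha> alpha0_bounds by simp_all
  note r = r0(1,2)[OF \<alpha>(1) \<alpha>'(2)]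
  have circle: "(Re (kphi \<alpha> z) / h1 \<alpha>)\<^sup>2 + (Im (kphi \<alpha> z) / h2 \<alpha>)\<^sup>2 \<le> 1" if "norm z = r0 \<alpha>" for z
  proof (rule kphi_circle_in_ellipse[OF \<alpha>(1) \<alpha>'(2) that r])
    have "\<bar>Re z / r0 \<alpha>\<bar> \<le> 1" using abs_Re_le_cmod[of z] that r by (simp add: abs_divide)
    then have "- 1 \<le> Re z / r0 \<alpha>" "Re z / r0 \<alpha> \<le> 1" by (simp_all only: abs_le_iff) linarith
    then show "ellipse_gap \<alpha> (r0 \<alpha>) (h1 \<alpha>) (h2 \<alpha>) (Re z / r0 \<alpha>) \<le> 0"
      using r0_gap_nonpos[OF \<alpha>] unfolding r0_gap_def by blast
  qed
  show ?thesis
  proof (rule F_radius_valid_real[OF \<alpha>(1) \<alpha>'(2) r])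
    fix z :: complex assume "norm z < r0 \<alpha>"
    from kphi_disc_in_ellipse[OF \<alpha>(1) \<alpha>'(2) r h1_h2_pos[OF \<alpha>(1) \<alpha>'(2)] circle this]
    show "2 * \<alpha> * \<bar>Im (kphi \<alpha> z)\<bar> < pi \<and>
      (1 - \<alpha>\<^sup>2) * cosh (2 * \<alpha> * Re (kphi \<alpha> z)) < (1 + \<alpha>\<^sup>2) * cos (2 * \<alpha> * Im (kphi \<alpha> z))"
      using ellipse_in_psi_region_real[OF \<alpha>(1) \<alpha>'(1)] by blast
  qed
qed

theorem theorem3p7:
  fixes \<alpha> :: real
  assumes "0 < \<alpha>" and "\<alpha> < 1"
  shows "alpha0_solutions \<noteq> {} \<and> 0 < alpha0 \<and> alpha0 < 1 \<and>
    (\<alpha> \<le> alpha0 \<longrightarrow>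
       F_radius_valid \<alpha> (of_real \<alpha>) (- of_real \<alpha>) (r0 \<alpha>) \<and>
       F_radius_sharp \<alpha> (of_real \<alpha>) (- of_real \<alpha>) (r0 \<alpha>)) \<and>
    (alpha0 < \<alpha> \<longrightarrow>
       F_radius_valid \<alpha> (of_real \<alpha>) (- of_real \<alpha>) (r1 \<alpha>)) \<and>
    (\<forall>\<gamma>. 0 < \<gamma> \<and> \<gamma> \<le> pi / 2 \<longrightarrow>
       F_radius_valid \<alpha> (of_real \<alpha> * exp (\<i> * of_real \<gamma>)) (of_real \<alpha> * exp (- \<i> * of_real \<gamma>)) (r2 \<alpha> \<gamma>) \<and>
       F_radius_sharp \<alpha> (of_real \<alpha> * exp (\<i> * of_real \<gamma>)) (of_real \<alpha> * exp (- \<i> * of_real \<gamma>)) (r2 \<alpha> \<gamma>))"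
proof (intro conjI impI allI)
  show "alpha0_solutions \<noteq> {}" using solution_bounds(1) by blast
  show "0 < alpha0" "alpha0 < 1" using alpha0_bounds by simp_all
qed (use assms F_radius_valid_r0 F_radius_sharp_r0 F_radius_valid_r1 arc_radius in auto)

end
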